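(* Let $\lambda\leq\mu$ be regular cardinals and let $\mathcal K$ be a category which is $\mathcal M$-locally $\lambda$-generated and locally $\mu$-presentable. Let $T$ be a $\mu$-ary monad on $\mathcal K$ which preserves $\mathcal M$-morphisms and $\lambda$-directed colimits of $\mathcal M$-morphisms. Then there is a $\lambda$-ary equational theory $E$ over $\mathcal K$ such that the category $\mathcal K^T$ of $T$-algebras and $\mathbf{Alg}(E)$ are equivalent as concrete categories over $\mathcal K$ (i.e. compatibly with the forgetful functors to $\mathcal K$).
   Context: A monad on a locally presentable category is $\mu$-ary if it preserves $\mu$-filtered (equivalently $\mu$-directed) colimits. A monad preserves $\lambda$-directed colimits of $\mathcal M$-morphisms if it sends colimits of $\lambda$-directed diagrams whose connecting morphisms are in $\mathcal M$ to $\lambda$-directed colimits. Locally generated categories. A factorization system $(\mathcal E,\mathcal M)$ on a category $\mathcal K$ is $\lambda$-convenient if (1) $\mathcal K$ is $\mathcal E$-cowellpowered, i.e. every object has only a set of $\mathcal E$-quotients up to isomorphism, and (2) $\mathcal M$ is closed under $\lambda$-directed colimits: for every $\lambda$-directed diagram of $\mathcal M$-morphisms, the colimit cocone consists of $\mathcal M$-morphisms, and for every cocone of $\mathcal M$-morphisms the induced morphism from the colimit is in $\mathcal M$. An object $A$ is $\lambda$-generated w.r.t. $\mathcal M$ if $\mathcal K(A,-):\mathcal K\to\mathbf{Set}$ preserves $\lambda$-directed colimits of $\mathcal M$-morphisms. A cocomplete category $\mathcal K$ with a $\lambda$-convenient factorization system $(\mathcal E,\mathcal M)$ is $\mathcal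 M$-locally $\lambda$-generated if it has a set $\mathcal A$ of objects $\lambda$-generated w.r.t. $\mathcal M$ such that every object of $\mathcal K$ is a $\lambda$-directed colimit of objects from $\mathcal A$ and morphisms from $\mathcal M$. Equational theories. For objects $X,A$ of $\mathcal K$ write $A^X$ for the set $\mathcal K(X,A)$; for $f:Y\to X$ write $A^f=\mathcal K(f,A):A^X\to A^Y$, and for $h:A\to B$ write $h^X=\mathcal K(X,h)$. Let $\mathcal A$ be a full subcategory of $\mathcal K$. An $\mathcal A$-ary type $t$ is a class $\Omega$ with a mapping $t:\Omega\to\mathrm{ob}(\mathcal A)\times\mathrm{ob}(\mathcal A)$ such that $\Omega^{X,Y}=t^{-1}(X,Y)$ is a set for all $X,Y$. Elements of $\Omega^{X,Y}$ are $(X,Y)$-ary operation symbols. Terms: every $\omega\in\Omega^{X,Y}$ is an $(X,Y)$-ary term; every morphism $f:Y\to X$ of $\mathcal A$ determines an $(X,Y)$-ary term $x_f$; if $p$ is an $(X,Y)$-ary term and $q$ a $(Y,Z)$-ary term then $qp$ is an $(X,Z)$-ary term; terms are identified according to $x_{fg}=x_gx_f$, $(pq)r=p(qr)$, $x_{\mathrm{id}_Y}p=p=px_{\mathrm{id}_X}$. An equation is a pair of terms of the same arity, and an equational theory $E$ of type $t$ is a class of equations. An algebra of type $t$ is an object $A$ of $\mathcal K$ with mappings $\omega_A:A^X\to A^Y$ for $\omega\in\Omega^{X,Y}$; terms are interpreted by $(x_f)_A=A^f$, $(qp)_A=q_Ap_A$. An $E$-algebra is an algebra with $p_A=q_A$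 for every equation $p=q$ in $E$. A homomorphism $A\to B$ is a morphism $h$ of $\mathcal K$ with $h^Y\omega_A=\omega_Bh^X$ for all $\omega\in\Omega^{X,Y}$. This gives the category $\mathbf{Alg}(E)$ with forgetful functor to $\mathcal K$. Over an $\mathcal M$-locally $\lambda$-generated category $\mathcal K$, a type is $\lambda$-ary if all arities $X,Y$ of its operation symbols are $\lambda$-generated w.r.t. $\mathcal M$ (so $\mathcal A$ is a representative small full subcategory of the objects $\lambda$-generated w.r.t. $\mathcal M$); a theory is $\lambda$-ary if its type is. *)

theory Defs
  imports "HOL-Library.FuncSet"
begin

unbundle cardinal_syntax

text \<open>
  The set/class distinction is rendered by a strongly inaccessible cardinal \<open>\<kappa>\<close> (a Grothendieck
  universe): a ``set'' is a collection of cardinality below \<open>\<kappa>\<close>, while an arbitrary HOL set plays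
  the role of a class.  The carrier type \<open>'u\<close> of \<open>\<kappa>\<close> serves as the ambient universe: it is the type
  of the morphisms of the base category, of the elements of the sets in \<open>Set\<close>, of the indices of
  small diagrams and of the operation symbols.  Only the cardinality of the universe matters and
  \<open>'u\<close> may be enlarged as necessary, so this loses no generality.
\<close>

definition inaccessible :: "'u rel \<Rightarrow> bool" where
  "inaccessible \<kappa> \<longleftrightarrow> Card_order \<kappa> \<and> natLeq <o \<kappa> \<and> regularCard \<kappa> \<and>
     (\<forall>A :: 'u set. |A| <o \<kappa> \<longrightarrow> |Pow A| <o \<kappa>)"

definition regular_cardinal :: "'l rel \<Rightarrow> bool" where
  "regular_cardinal \<alpha> \<longleftrightarrow> Cinfinite \<alpha> \<and> regularCard \<alpha>"

definition small :: "'u rel \<Rightarrow> 'b set \<Rightarrow> bool" where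
  "small \<kappa> A \<longleftrightarrow> |A| <o \<kappa>"


section \<open>Categories, functors, colimits\<close>

text \<open>\<open>g \<cdot> f\<close> is composition in the usual (``\<open>g\<close> after \<open>f\<close>'') order; only its values on
  composable morphisms are meaningful.\<close>

record ('o, 'a) cat =
  Ob :: "'o set"
  Ar :: "'a set"
  Src :: "'a \<Rightarrow> 'o"
  Tgt :: "'a \<Rightarrow> 'o"
  One :: "'o \<Rightarrow> 'a"
  Cmp :: "'a \<Rightarrow> 'a \<Rightarrow> 'a" (infixl "\<cdot>\<index>" 70)

definition hom :: "('o, 'a) cat \<Rightarrow> 'o \<Rightarrow> 'o \<Rightarrow> 'a set" where
  "hom C X Y = {f \<in> Ar C. Src C f = X \<and> Tgt C f = Y}"

locale category =
  fixes C :: "('o, 'a) cat" (structure)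
  assumes Src_Ob: "f \<in> Ar C \<Longrightarrow> Src C f \<in> Ob C"
    and Tgt_Ob: "f \<in> Ar C \<Longrightarrow> Tgt C f \<in> Ob C"
    and One_hom: "X \<in> Ob C \<Longrightarrow> One C X \<in> hom C X X"
    and Cmp_hom: "f \<in> hom C X Y \<Longrightarrow> g \<in> hom C Y Z \<Longrightarrow> g \<cdot> f \<in> hom C X Z"
    and One_left: "f \<in> hom C X Y \<Longrightarrow> One C Y \<cdot> f = f"
    and One_right: "f \<in> hom C X Y \<Longrightarrow> f \<cdot> One C X = f"
    and Cmp_assoc: "f \<in> hom C W X \<Longrightarrow> g \<in> hom C X Y \<Longrightarrow> h \<in> hom C Y Z \<Longrightarrow>
      h \<cdot> (g \<cdot> f) = (h \<cdot> g) \<cdot> f"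

definition locally_small :: "'u rel \<Rightarrow> ('o, 'a) cat \<Rightarrow> bool" where
  "locally_small \<kappa> C \<longleftrightarrow> (\<forall>X \<in> Ob C. \<forall>Y \<in> Ob C. small \<kappa> (hom C X Y))"

definition iso_arrow :: "('o, 'a) cat \<Rightarrow> 'a \<Rightarrow> bool" where
  "iso_arrow C f \<longleftrightarrow> f \<in> Ar C \<and>
     (\<exists>g \<in> hom C (Tgt C f) (Src C f).
        g \<cdot>\<^bsub>C\<^esub> f = One C (Src C f) \<and> f \<cdot>\<^bsub>C\<^esub> g = One C (Tgt C f))"

definition isomorphic :: "('o, 'a) cat \<Rightarrow> 'o \<Rightarrow> 'o \<Rightarrow> bool" where
  "isomorphic C X Y \<longleftrightarrow> (\<exists>f \<in> hom C X Y. iso_arrow C f)"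

record ('o, 'a, 'p, 'b) func =
  on_ob :: "'o \<Rightarrow> 'p"
  on_ar :: "'a \<Rightarrow> 'b"

definition is_functor ::
  "('o, 'a) cat \<Rightarrow> ('p, 'b) cat \<Rightarrow> ('o, 'a, 'p, 'b) func \<Rightarrow> bool" where
  "is_functor C D F \<longleftrightarrow> category C \<and> category D \<and>
     (\<forall>X \<in> Ob C. on_ob F X \<in> Ob D) \<and>
     (\<forall>X \<in> Ob C. \<forall>Y \<in> Ob C. \<forall>f \<in> hom C X Y. on_ar F f \<in> hom D (on_ob F X) (on_ob F Y)) \<and>
     (\<forall>X \<in> Ob C. on_ar F (One C X) = One D (on_ob F X)) \<and>
     (\<forall>f \<in> Ar C. \<forall>g \<in> Ar C. Tgt C f = Src C g \<longrightarrow>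
        on_ar F (g \<cdot>\<^bsub>C\<^esub> f) = on_ar F g \<cdot>\<^bsub>D\<^esub> on_ar F f)"

definition id_func :: "('o, 'a, 'o, 'a) func" where
  "id_func = \<lparr>on_ob = (\<lambda>X. X), on_ar = (\<lambda>f. f)\<rparr>"

definition comp_func ::
  "('p, 'b, 'q, 'c) func \<Rightarrow> ('o, 'a, 'p, 'b) func \<Rightarrow> ('o, 'a, 'q, 'c) func" where
  "comp_func G F = \<lparr>on_ob = on_ob G \<circ> on_ob F, on_ar = on_ar G \<circ> on_ar F\<rparr>"

definition nat_transf ::
  "('o, 'a) cat \<Rightarrow> ('p, 'b) cat \<Rightarrow> ('o, 'a, 'p, 'b) func \<Rightarrow> ('o, 'a, 'p, 'b) func \<Rightarrow>
   ('o \<Rightarrow> 'b) \<Rightarrow> bool" where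
  "nat_transf C D F G \<tau> \<longleftrightarrow> is_functor C D F \<and> is_functor C D G \<and>
     (\<forall>X \<in> Ob C. \<tau> X \<in> hom D (on_ob F X) (on_ob G X)) \<and>
     (\<forall>f \<in> Ar C. \<tau> (Tgt C f) \<cdot>\<^bsub>D\<^esub> on_ar F f = on_ar G f \<cdot>\<^bsub>D\<^esub> \<tau> (Src C f))"

definition nat_iso ::
  "('o, 'a) cat \<Rightarrow> ('p, 'b) cat \<Rightarrow> ('o, 'a, 'p, 'b) func \<Rightarrow> ('o, 'a, 'p, 'b) func \<Rightarrow>
   ('o \<Rightarrow> 'b) \<Rightarrow> bool" where
  "nat_iso C D F G \<tau> \<longleftrightarrow> nat_transf C D F G \<tau> \<and> (\<forall>X \<in> Ob C. iso_arrow D (\<tau> X))"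

definition cocone ::
  "('i, 'j) cat \<Rightarrow> ('o, 'a) cat \<Rightarrow> ('i, 'j, 'o, 'a) func \<Rightarrow> 'o \<Rightarrow> ('i \<Rightarrow> 'a) \<Rightarrow> bool" where
  "cocone J C D X c \<longleftrightarrow> is_functor J C D \<and> X \<in> Ob C \<and>
     (\<forall>i \<in> Ob J. c i \<in> hom C (on_ob D i) X) \<and>
     (\<forall>u \<in> Ar J. c (Tgt J u) \<cdot>\<^bsub>C\<^esub> on_ar D u = c (Src J u))"

definition is_colimit ::
  "('i, 'j) cat \<Rightarrow> ('o, 'a) cat \<Rightarrow> ('i, 'j, 'o, 'a) func \<Rightarrow> 'o \<Rightarrow> ('i \<Rightarrow> 'a) \<Rightarrow> bool" where
  "is_colimit J C D X c \<longleftrightarrow> cocone J C D X c \<and>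
     (\<forall>Y d. cocone J C D Y d \<longrightarrow> (\<exists>!h. h \<in> hom C X Y \<and> (\<forall>i \<in> Ob J. h \<cdot>\<^bsub>C\<^esub> c i = d i)))"

text \<open>Every small category is isomorphic to one with objects and morphisms in the universe
  type \<open>'u\<close>, so it suffices to consider index categories of that type.\<close>

definition cocomplete :: "'u rel \<Rightarrow> ('o, 'a) cat \<Rightarrow> bool" where
  "cocomplete \<kappa> C \<longleftrightarrow> category C \<and>
     (\<forall>(J :: ('u, 'u) cat) D. category J \<and> small \<kappa> (Ob J) \<and> small \<kappa> (Ar J) \<and> is_functor J C D \<longrightarrow>
        (\<exists>X c. is_colimit J C D X c))"

definition SetCat :: "'u rel \<Rightarrow> ('u set, 'u set \<times> ('u \<Rightarrow> 'u) \<times> 'u set) cat" where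
  "SetCat \<kappa> =
     \<lparr>Ob = {V. small \<kappa> V},
      Ar = {(V, f, W). small \<kappa> V \<and> small \<kappa> W \<and> f \<in> V \<rightarrow>\<^sub>E W},
      Src = (\<lambda>(V, f, W). V),
      Tgt = (\<lambda>(V, f, W). W),
      One = (\<lambda>V. (V, restrict (\<lambda>x. x) V, V)),
      Cmp = (\<lambda>(V', g, W') (V, f, W). (V, compose V g f, W'))\<rparr>"

text \<open>The covariant hom-functor \<open>\<K>(A, -)\<close> into \<open>SetCat \<kappa>\<close>.\<close>

definition hom_func ::
  "('o, 'u) cat \<Rightarrow> 'o \<Rightarrow> ('o, 'u, 'u set, 'u set \<times> ('u \<Rightarrow> 'u) \<times> 'u set) func" where
  "hom_func K A =
     \<lparr>on_ob = (\<lambda>X. hom K A X),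
      on_ar = (\<lambda>f. (hom K A (Src K f), restrict (\<lambda>g. f \<cdot>\<^bsub>K\<^esub> g) (hom K A (Src K f)),
                    hom K A (Tgt K f)))\<rparr>"


section \<open>Directed colimits\<close>

text \<open>A poset is given by its order relation \<open>r\<close>, with underlying set \<open>Field r\<close>.\<close>

definition directed_poset :: "'u rel \<Rightarrow> 'l rel \<Rightarrow> 'i rel \<Rightarrow> bool" where
  "directed_poset \<kappa> \<alpha> r \<longleftrightarrow> Partial_order r \<and> small \<kappa> (Field r) \<and>
     (\<forall>S \<subseteq> Field r. |S| <o \<alpha> \<longrightarrow> (\<exists>b \<in> Field r. \<forall>a \<in> S. (a, b) \<in> r))"

definition poset_cat :: "'i rel \<Rightarrow> ('i, 'i \<times> 'i) cat" where
  "poset_cat r = \<lparr>Ob = Field r, Ar = r, Src = fst, Tgt = snd, One = (\<lambda>i. (i, i)),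
     Cmp = (\<lambda>v u. (fst u, snd v))\<rparr>"

definition directed_diagram ::
  "'u rel \<Rightarrow> 'l rel \<Rightarrow> ('o, 'a) cat \<Rightarrow> 'a set \<Rightarrow> 'u rel \<Rightarrow> ('u, 'u \<times> 'u, 'o, 'a) func \<Rightarrow> bool" where
  "directed_diagram \<kappa> \<alpha> C M r D \<longleftrightarrow>
     directed_poset \<kappa> \<alpha> r \<and> is_functor (poset_cat r) C D \<and> (\<forall>u \<in> r. on_ar D u \<in> M)"

text \<open>With \<open>M = Ar C\<close> this is preservation of all \<open>\<alpha>\<close>-directed colimits.\<close>

definition preserves_directed_colimits ::
  "'u rel \<Rightarrow> 'l rel \<Rightarrow> ('o, 'a) cat \<Rightarrow> 'a set \<Rightarrow> ('p, 'b) cat \<Rightarrow> ('o, 'a, 'p, 'b) func \<Rightarrow> bool" where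
  "preserves_directed_colimits \<kappa> \<alpha> C M B F \<longleftrightarrow> is_functor C B F \<and>
     (\<forall>r D X c. directed_diagram \<kappa> \<alpha> C M r D \<and> is_colimit (poset_cat r) C D X c \<longrightarrow>
        is_colimit (poset_cat r) B (comp_func F D) (on_ob F X) (\<lambda>i. on_ar F (c i)))"

definition directed_colimit_of ::
  "'u rel \<Rightarrow> 'l rel \<Rightarrow> ('o, 'a) cat \<Rightarrow> 'a set \<Rightarrow> 'o set \<Rightarrow> 'o \<Rightarrow> bool" where
  "directed_colimit_of \<kappa> \<alpha> C M \<A> X \<longleftrightarrow>
     (\<exists>r D c. directed_diagram \<kappa> \<alpha> C M r D \<and> (\<forall>i \<in> Field r. on_ob D i \<in> \<A>) \<and>
        is_colimit (poset_cat r) C D X c)"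

definition generated_object ::
  "'u rel \<Rightarrow> 'l rel \<Rightarrow> ('o, 'u) cat \<Rightarrow> 'u set \<Rightarrow> 'o \<Rightarrow> bool" where
  "generated_object \<kappa> \<alpha> K M A \<longleftrightarrow> A \<in> Ob K \<and>
     preserves_directed_colimits \<kappa> \<alpha> K M (SetCat \<kappa>) (hom_func K A)"

definition presentable_object :: "'u rel \<Rightarrow> 'l rel \<Rightarrow> ('o, 'u) cat \<Rightarrow> 'o \<Rightarrow> bool" where
  "presentable_object \<kappa> \<alpha> K A \<longleftrightarrow> A \<in> Ob K \<and>
     preserves_directed_colimits \<kappa> \<alpha> K (Ar K) (SetCat \<kappa>) (hom_func K A)"

definition locally_presentable :: "'u rel \<Rightarrow> 'l rel \<Rightarrow> ('o, 'u) cat \<Rightarrow> bool" where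
  "locally_presentable \<kappa> \<alpha> K \<longleftrightarrow> cocomplete \<kappa> K \<and>
     (\<exists>\<A>. small \<kappa> \<A> \<and> (\<forall>A \<in> \<A>. presentable_object \<kappa> \<alpha> K A) \<and>
        (\<forall>X \<in> Ob K. directed_colimit_of \<kappa> \<alpha> K (Ar K) \<A> X))"


section \<open>Factorization systems and locally generated categories\<close>

definition factorization_system :: "('o, 'a) cat \<Rightarrow> 'a set \<Rightarrow> 'a set \<Rightarrow> bool" where
  "factorization_system K E M \<longleftrightarrow> category K \<and> E \<subseteq> Ar K \<and> M \<subseteq> Ar K \<and>
     (\<forall>f. iso_arrow K f \<longrightarrow> f \<in> E \<and> f \<in> M) \<and>
     (\<forall>f \<in> E. \<forall>g \<in> E. Tgt K f = Src K g \<longrightarrow> g \<cdot>\<^bsub>K\<^esub> f \<in> E) \<and>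
     (\<forall>f \<in> M. \<forall>g \<in> M. Tgt K f = Src K g \<longrightarrow> g \<cdot>\<^bsub>K\<^esub> f \<in> M) \<and>
     (\<forall>f \<in> Ar K. \<exists>e \<in> E. \<exists>m \<in> M. Tgt K e = Src K m \<and> f = m \<cdot>\<^bsub>K\<^esub> e) \<and>
     (\<forall>e \<in> E. \<forall>m \<in> M. \<forall>u \<in> hom K (Src K e) (Src K m). \<forall>v \<in> hom K (Tgt K e) (Tgt K m).
        v \<cdot>\<^bsub>K\<^esub> e = m \<cdot>\<^bsub>K\<^esub> u \<longrightarrow>
        (\<exists>!d. d \<in> hom K (Tgt K e) (Src K m) \<and> d \<cdot>\<^bsub>K\<^esub> e = u \<and> m \<cdot>\<^bsub>K\<^esub> d = v))"

definition cowellpowered :: "'u rel \<Rightarrow> ('o, 'a) cat \<Rightarrow> 'a set \<Rightarrow> bool" where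
  "cowellpowered \<kappa> K E \<longleftrightarrow>
     (\<forall>X \<in> Ob K. \<exists>Q. small \<kappa> Q \<and> Q \<subseteq> {e \<in> E. Src K e = X} \<and>
        (\<forall>e \<in> E. Src K e = X \<longrightarrow>
           (\<exists>q \<in> Q. \<exists>i \<in> hom K (Tgt K q) (Tgt K e). iso_arrow K i \<and> i \<cdot>\<^bsub>K\<^esub> q = e)))"

definition closed_under_directed_colimits ::
  "'u rel \<Rightarrow> 'l rel \<Rightarrow> ('o, 'a) cat \<Rightarrow> 'a set \<Rightarrow> bool" where
  "closed_under_directed_colimits \<kappa> \<alpha> K M \<longleftrightarrow>
     (\<forall>r D X c. directed_diagram \<kappa> \<alpha> K M r D \<and> is_colimit (poset_cat r) K D X c \<longrightarrow>
        (\<forall>i \<in> Field r. c i \<in> M) \<and>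
        (\<forall>Y d h. cocone (poset_cat r) K D Y d \<and> (\<forall>i \<in> Field r. d i \<in> M) \<and>
           h \<in> hom K X Y \<and> (\<forall>i \<in> Field r. h \<cdot>\<^bsub>K\<^esub> c i = d i) \<longrightarrow> h \<in> M))"

definition convenient ::
  "'u rel \<Rightarrow> 'l rel \<Rightarrow> ('o, 'a) cat \<Rightarrow> 'a set \<Rightarrow> 'a set \<Rightarrow> bool" where
  "convenient \<kappa> \<alpha> K E M \<longleftrightarrow> factorization_system K E M \<and> cowellpowered \<kappa> K E \<and>
     closed_under_directed_colimits \<kappa> \<alpha> K M"

definition locally_generated ::
  "'u rel \<Rightarrow> 'l rel \<Rightarrow> ('o, 'u) cat \<Rightarrow> 'u set \<Rightarrow> 'u set \<Rightarrow> bool" where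
  "locally_generated \<kappa> \<alpha> K E M \<longleftrightarrow> cocomplete \<kappa> K \<and> convenient \<kappa> \<alpha> K E M \<and>
     (\<exists>\<A>. small \<kappa> \<A> \<and> (\<forall>A \<in> \<A>. generated_object \<kappa> \<alpha> K M A) \<and>
        (\<forall>X \<in> Ob K. directed_colimit_of \<kappa> \<alpha> K M \<A> X))"


section \<open>Concrete categories over \<open>K\<close>\<close>

text \<open>Objects of \<open>K\<close> equipped with structure of type \<open>'s\<close>: \<open>S\<close> is the class of structured objects
  and \<open>H x y h\<close> says that the \<open>K\<close>-morphism \<open>h\<close> between underlying objects is structure preserving.\<close>

definition structured_cat ::
  "('o, 'a) cat \<Rightarrow> ('o \<times> 's) set \<Rightarrow> ('o \<times> 's \<Rightarrow> 'o \<times> 's \<Rightarrow> 'a \<Rightarrow> bool) \<Rightarrow>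
   ('o \<times> 's, ('o \<times> 's) \<times> 'a \<times> ('o \<times> 's)) cat" where
  "structured_cat K S H =
     \<lparr>Ob = S,
      Ar = {(x, h, y). x \<in> S \<and> y \<in> S \<and> h \<in> hom K (fst x) (fst y) \<and> H x y h},
      Src = (\<lambda>(x, h, y). x),
      Tgt = (\<lambda>(x, h, y). y),
      One = (\<lambda>x. (x, One K (fst x), x)),
      Cmp = (\<lambda>(y', g, z) (x, f, y). (x, g \<cdot>\<^bsub>K\<^esub> f, z))\<rparr>"

definition forgetful ::
  "('o \<times> 's, ('o \<times> 's) \<times> 'a \<times> ('o \<times> 's), 'o, 'a) func" where
  "forgetful = \<lparr>on_ob = fst, on_ar = (\<lambda>(x, h, y). h)\<rparr>"

definition concrete_functor ::
  "('p, 'b) cat \<Rightarrow> ('p, 'b, 'o, 'a) func \<Rightarrow> ('q, 'c) cat \<Rightarrow> ('q, 'c, 'o, 'a) func \<Rightarrow>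
   ('p, 'b, 'q, 'c) func \<Rightarrow> bool" where
  "concrete_functor A U B V F \<longleftrightarrow> is_functor A B F \<and>
     (\<forall>X \<in> Ob A. on_ob V (on_ob F X) = on_ob U X) \<and>
     (\<forall>f \<in> Ar A. on_ar V (on_ar F f) = on_ar U f)"

text \<open>Equivalence in the 2-category of categories over \<open>K\<close>: the functors commute strictly with the
  forgetful functors, and the invertible 2-cells lie over identities of \<open>K\<close>.\<close>

definition concretely_equivalent ::
  "('o, 'a) cat \<Rightarrow> ('p, 'b) cat \<Rightarrow> ('p, 'b, 'o, 'a) func \<Rightarrow>
   ('q, 'c) cat \<Rightarrow> ('q, 'c, 'o, 'a) func \<Rightarrow> bool" where
  "concretely_equivalent K A U B V \<longleftrightarrow> is_functor A K U \<and> is_functor B K V \<and>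
     (\<exists>F G \<eta> \<epsilon>. concrete_functor A U B V F \<and> concrete_functor B V A U G \<and>
        nat_iso A A id_func (comp_func G F) \<eta> \<and> (\<forall>X \<in> Ob A. on_ar U (\<eta> X) = One K (on_ob U X)) \<and>
        nat_iso B B (comp_func F G) id_func \<epsilon> \<and> (\<forall>Y \<in> Ob B. on_ar V (\<epsilon> Y) = One K (on_ob V Y)))"


section \<open>Monads and their algebras\<close>

definition monad ::
  "('o, 'a) cat \<Rightarrow> ('o, 'a, 'o, 'a) func \<Rightarrow> ('o \<Rightarrow> 'a) \<Rightarrow> ('o \<Rightarrow> 'a) \<Rightarrow> bool" where
  "monad K T \<eta> m \<longleftrightarrow> nat_transf K K id_func T \<eta> \<and> nat_transf K K (comp_func T T) T m \<and>
     (\<forall>X \<in> Ob K.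
        m X \<cdot>\<^bsub>K\<^esub> on_ar T (\<eta> X) = One K (on_ob T X) \<and>
        m X \<cdot>\<^bsub>K\<^esub> \<eta> (on_ob T X) = One K (on_ob T X) \<and>
        m X \<cdot>\<^bsub>K\<^esub> on_ar T (m X) = m X \<cdot>\<^bsub>K\<^esub> m (on_ob T X))"

definition EM_cat ::
  "('o, 'a) cat \<Rightarrow> ('o, 'a, 'o, 'a) func \<Rightarrow> ('o \<Rightarrow> 'a) \<Rightarrow> ('o \<Rightarrow> 'a) \<Rightarrow>
   ('o \<times> 'a, ('o \<times> 'a) \<times> 'a \<times> ('o \<times> 'a)) cat" where
  "EM_cat K T \<eta> m = structured_cat K
     {(A, a). A \<in> Ob K \<and> a \<in> hom K (on_ob T A) A \<and>
        a \<cdot>\<^bsub>K\<^esub> \<eta> A = One K A \<and> a \<cdot>\<^bsub>K\<^esub> on_ar T a = a \<cdot>\<^bsub>K\<^esub> m A}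
     (\<lambda>(A, a) (B, b) h. h \<cdot>\<^bsub>K\<^esub> a = b \<cdot>\<^bsub>K\<^esub> on_ar T h)"


section \<open>Equational theories\<close>

text \<open>\<open>obs t\<close> is the class of objects of the full subcategory of arities.\<close>

record ('o, 'w) op_type =
  obs :: "'o set"
  syms :: "'w set"
  arity :: "'w \<Rightarrow> 'o \<times> 'o"

definition is_op_type :: "'u rel \<Rightarrow> ('o, 'a) cat \<Rightarrow> ('o, 'w) op_type \<Rightarrow> bool" where
  "is_op_type \<kappa> K t \<longleftrightarrow> obs t \<subseteq> Ob K \<and> (\<forall>w \<in> syms t. arity t w \<in> obs t \<times> obs t) \<and>
     (\<forall>X \<in> obs t. \<forall>Y \<in> obs t. small \<kappa> {w \<in> syms t. arity t w = (X, Y)})"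

datatype ('w, 'a) raw_term =
    Sym 'w
  | Var 'a
  | App "('w, 'a) raw_term" "('w, 'a) raw_term"

text \<open>\<open>Var f\<close> stands for \<open>x\<^sub>f\<close> and \<open>App q p\<close> for the composite \<open>qp\<close>, in which \<open>p\<close> is applied first.\<close>

inductive raw_term_of ::
  "('o, 'a) cat \<Rightarrow> ('o, 'w) op_type \<Rightarrow> 'o \<Rightarrow> 'o \<Rightarrow> ('w, 'a) raw_term \<Rightarrow> bool"
  for K t where
  Sym: "w \<in> syms t \<Longrightarrow> arity t w = (X, Y) \<Longrightarrow> raw_term_of K t X Y (Sym w)"
| Var: "X \<in> obs t \<Longrightarrow> Y \<in> obs t \<Longrightarrow> f \<in> hom K Y X \<Longrightarrow> raw_term_of K t X Y (Var f)"
| App: "raw_term_of K t X Y p \<Longrightarrow> raw_term_of K t Y Z q \<Longrightarrow> raw_term_of K t X Z (App q p)"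

inductive term_eq ::
  "('o, 'a) cat \<Rightarrow> ('o, 'w) op_type \<Rightarrow> 'o \<Rightarrow> 'o \<Rightarrow> ('w, 'a) raw_term \<Rightarrow> ('w, 'a) raw_term \<Rightarrow> bool"
  for K t where
  refl: "raw_term_of K t X Y p \<Longrightarrow> term_eq K t X Y p p"
| sym: "term_eq K t X Y p q \<Longrightarrow> term_eq K t X Y q p"
| trans: "term_eq K t X Y p q \<Longrightarrow> term_eq K t X Y q r \<Longrightarrow> term_eq K t X Y p r"
| cong: "term_eq K t X Y p p' \<Longrightarrow> term_eq K t Y Z q q' \<Longrightarrow> term_eq K t X Z (App q p) (App q' p')"
| var: "X \<in> obs t \<Longrightarrow> Y \<in> obs t \<Longrightarrow> Z \<in> obs t \<Longrightarrow> f \<in> hom K Y X \<Longrightarrow> g \<in> hom K Z Y \<Longrightarrow>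
    term_eq K t X Z (Var (f \<cdot>\<^bsub>K\<^esub> g)) (App (Var g) (Var f))"
| assoc: "raw_term_of K t W X r \<Longrightarrow> raw_term_of K t X Y q \<Longrightarrow> raw_term_of K t Y Z p \<Longrightarrow>
    term_eq K t W Z (App (App p q) r) (App p (App q r))"
| id_left: "raw_term_of K t X Y p \<Longrightarrow> term_eq K t X Y (App (Var (One K Y)) p) p"
| id_right: "raw_term_of K t X Y p \<Longrightarrow> term_eq K t X Y (App p (Var (One K X))) p"

definition terms ::
  "('o, 'a) cat \<Rightarrow> ('o, 'w) op_type \<Rightarrow> 'o \<Rightarrow> 'o \<Rightarrow> ('w, 'a) raw_term set set" where
  "terms K t X Y = {p. raw_term_of K t X Y p} // {(p, q). term_eq K t X Y p q}"

definition equational_theory ::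
  "('o, 'a) cat \<Rightarrow> ('o, 'w) op_type \<Rightarrow> (('w, 'a) raw_term set \<times> ('w, 'a) raw_term set) set \<Rightarrow> bool"
  where
  "equational_theory K t E \<longleftrightarrow>
     (\<forall>e \<in> E. \<exists>X \<in> obs t. \<exists>Y \<in> obs t. e \<in> terms K t X Y \<times> terms K t X Y)"

text \<open>\<open>A\<^sup>X\<close> is \<open>hom K X A\<close>; the operations of an algebra are extensional, so that an algebra is
  determined by its operations.\<close>

definition algebras ::
  "('o, 'a) cat \<Rightarrow> ('o, 'w) op_type \<Rightarrow> ('o \<times> ('w \<Rightarrow> 'a \<Rightarrow> 'a)) set" where
  "algebras K t = {(A, ops). A \<in> Ob K \<and>
     ops \<in> (\<Pi>\<^sub>E w \<in> syms t. hom K (fst (arity t w)) A \<rightarrow>\<^sub>E hom K (snd (arity t w)) A)}"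

text \<open>The value of \<open>raw_interp K ops p\<close> is meaningful only at elements of \<open>hom K X A\<close>, when \<open>p\<close> is
  \<open>(X, Y)\<close>-ary.  On these, it depends only on the class of \<open>p\<close> (\<open>term_eq_interp\<close>), so the choice
  of representative in \<open>interp\<close> is immaterial.\<close>

primrec raw_interp ::
  "('o, 'a) cat \<Rightarrow> ('w \<Rightarrow> 'a \<Rightarrow> 'a) \<Rightarrow> ('w, 'a) raw_term \<Rightarrow> 'a \<Rightarrow> 'a" where
  "raw_interp K ops (Sym w) = ops w"
| "raw_interp K ops (Var f) = (\<lambda>a. a \<cdot>\<^bsub>K\<^esub> f)"
| "raw_interp K ops (App q p) = raw_interp K ops q \<circ> raw_interp K ops p"

definition interp ::
  "('o, 'a) cat \<Rightarrow> ('w \<Rightarrow> 'a \<Rightarrow> 'a) \<Rightarrow> ('w, 'a) raw_term set \<Rightarrow> 'a \<Rightarrow> 'a" where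
  "interp K ops P = raw_interp K ops (SOME p. p \<in> P)"

definition satisfies ::
  "('o, 'a) cat \<Rightarrow> ('o, 'w) op_type \<Rightarrow> (('w, 'a) raw_term set \<times> ('w, 'a) raw_term set) set \<Rightarrow>
   'o \<times> ('w \<Rightarrow> 'a \<Rightarrow> 'a) \<Rightarrow> bool" where
  "satisfies K t E = (\<lambda>(A, ops). \<forall>(P, Q) \<in> E. \<forall>X \<in> obs t. \<forall>Y \<in> obs t.
     P \<in> terms K t X Y \<and> Q \<in> terms K t X Y \<longrightarrow>
     (\<forall>a \<in> hom K X A. interp K ops P a = interp K ops Q a))"

definition Alg ::
  "('o, 'a) cat \<Rightarrow> ('o, 'w) op_type \<Rightarrow> (('w, 'a) raw_term set \<times> ('w, 'a) raw_term set) set \<Rightarrow>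
   ('o \<times> ('w \<Rightarrow> 'a \<Rightarrow> 'a),
    ('o \<times> ('w \<Rightarrow> 'a \<Rightarrow> 'a)) \<times> 'a \<times> ('o \<times> ('w \<Rightarrow> 'a \<Rightarrow> 'a))) cat" where
  "Alg K t E = structured_cat K {x \<in> algebras K t. satisfies K t E x}
     (\<lambda>(A, opsA) (B, opsB) h. \<forall>w \<in> syms t. \<forall>a \<in> hom K (fst (arity t w)) A.
        h \<cdot>\<^bsub>K\<^esub> opsA w a = opsB w (h \<cdot>\<^bsub>K\<^esub> a))"

text \<open>The arities form a small full subcategory that represents, up to isomorphism, all objects
  which are \<open>\<alpha>\<close>-generated with respect to \<open>M\<close>.\<close>

definition generated_ary ::
  "'u rel \<Rightarrow> 'l rel \<Rightarrow> ('o, 'u) cat \<Rightarrow> 'u set \<Rightarrow> ('o, 'w) op_type \<Rightarrow> bool" where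
  "generated_ary \<kappa> \<alpha> K M t \<longleftrightarrow> is_op_type \<kappa> K t \<and> small \<kappa> (obs t) \<and>
     (\<forall>X \<in> obs t. generated_object \<kappa> \<alpha> K M X) \<and>
     (\<forall>X. generated_object \<kappa> \<alpha> K M X \<longrightarrow> (\<exists>Y \<in> obs t. isomorphic K X Y))"

lemma raw_interp_hom:
  assumes "category K" "(A, ops) \<in> algebras K t" "raw_term_of K t X Y p" "a \<in> hom K X A"
  shows "raw_interp K ops p a \<in> hom K Y A"
  using assms(3,4)
proof (induction arbitrary: a rule: raw_term_of.induct)
  case (Sym w X Y)
  have "ops \<in> (\<Pi>\<^sub>E w \<in> syms t. hom K (fst (arity t w)) A \<rightarrow>\<^sub>E hom K (snd (arity t w)) A)"
    using assms(2) by (simp add: algebras_def)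
  from PiE_mem[OF this Sym.hyps(1)] have "ops w \<in> hom K X A \<rightarrow>\<^sub>E hom K Y A"
    using Sym.hyps(2) by simp
  from PiE_mem[OF this Sym.prems] show ?case by simp
next
  case (Var X Y f)
  then show ?case using category.Cmp_hom[OF assms(1)] by simp
next
  case (App X Y p Z q)
  then show ?case by simp
qed

lemma raw_term_obs:
  assumes "is_op_type \<kappa> K t" "raw_term_of K t X Y p"
  shows "X \<in> obs t \<and> Y \<in> obs t"
  using assms(2)
proof induction
  case (Sym w X Y)
  then have "(X, Y) \<in> obs t \<times> obs t" using assms(1) unfolding is_op_type_def by metis
  then show ?case by simp
qed simp_all

lemma term_eq_raw_term:
  assumes K: "category K" and t: "is_op_type \<kappa> K t" and "term_eq K t X Y p q"
  shows "raw_term_of K t X Y p \<and> raw_term_of K t X Y q"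
proof -
  have One: "raw_term_of K t X X (Var (One K X))" if "X \<in> obs t" for X
  proof -
    have "X \<in> Ob K" using that t by (auto simp: is_op_type_def)
    then show ?thesis using that category.One_hom[OF K] by (simp add: raw_term_of.Var)
  qed
  show ?thesis using assms(3)
  proof (induction rule: term_eq.induct)
    case (var X Y Z f g)
    have "f \<cdot>\<^bsub>K\<^esub> g \<in> hom K Z X" using category.Cmp_hom[OF K] var by simp
    then show ?case using var
      by (auto intro: raw_term_of.Var raw_term_of.App[where Y = Y])
  next
    case (assoc W X r Y q Z p)
    then show ?case
      by (auto intro: raw_term_of.App[where Y = X] raw_term_of.App[where Y = Y])
  next
    case (cong X Y p p' Z q q')
    then show ?case by (auto intro: raw_term_of.App[where Y = Y])
  next
    case (id_left X Y p)
    then have "raw_term_of K t X Y (App (Var (One K Y)) p)"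
      using raw_term_obs[OF t] One by (auto intro: raw_term_of.App[where Y = Y])
    then show ?case using id_left by simp
  next
    case (id_right X Y p)
    then have "raw_term_of K t X Y (App p (Var (One K X)))"
      using raw_term_obs[OF t] One by (auto intro: raw_term_of.App[where Y = X])
    then show ?case using id_right by simp
  qed simp_all
qed

lemma term_eq_interp:
  assumes K: "category K" and t: "is_op_type \<kappa> K t" and A: "(A, ops) \<in> algebras K t"
    and "term_eq K t X Y p q" "a \<in> hom K X A"
  shows "raw_interp K ops p a = raw_interp K ops q a"
  using assms(4,5)
proof (induction arbitrary: a rule: term_eq.induct)
  case (cong X Y p p' Z q q')
  have "raw_interp K ops p a \<in> hom K Y A"
    using raw_interp_hom[OF K A] term_eq_raw_term[OF K t cong.hyps(1)] cong.prems by blast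
  then have "raw_interp K ops q (raw_interp K ops p a) = raw_interp K ops q' (raw_interp K ops p a)"
    by (rule cong.IH(2))
  moreover have "raw_interp K ops p a = raw_interp K ops p' a"
    using cong.prems by (rule cong.IH(1))
  ultimately show ?case by simp
next
  case (var X Y Z f g)
  then show ?case using category.Cmp_assoc[OF K, of g Z Y f X a A] by simp
next
  case (id_left X Y p)
  then have "raw_interp K ops p a \<in> hom K Y A" by (intro raw_interp_hom[OF K A])
  then show ?case using category.One_right[OF K] by simp
next
  case (id_right X Y p)
  then show ?case using category.One_right[OF K] by simp
qed simp_all

end

theory Submission
  imports Defs
begin

text \<open>
  Take as arities a small set \<open>G\<close> of \<open>\<lambda>\<close>-generated objects, as \<open>(X, Y)\<close>-ary symbols the Kleisli
  morphisms \<open>\<omega> : Y \<rightarrow> T X\<close>, and as equations those expressing that units are variables and Kleisli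
  composition is composition of terms.  A \<open>T\<close>-algebra \<open>(A, a)\<close> interprets \<open>\<omega>\<close> by
  \<open>x \<mapsto> a \<cdot> T x \<cdot> \<omega>\<close>.  Conversely, every object is a \<open>\<lambda>\<close>-directed colimit of objects of \<open>G\<close> along
  \<open>M\<close>-morphisms, and this colimit is preserved by \<open>T\<close> and \<open>T T\<close>, while morphisms out of objects of
  \<open>G\<close> factor through its cocone.  Hence the operations at \<open>x : X \<rightarrow> A\<close> glue to a unique \<open>T X \<rightarrow> A\<close>,
  these glue to a unique \<open>a : T A \<rightarrow> A\<close>, and the algebra laws can be checked on objects of \<open>G\<close>.
\<close>

section \<open>Smallness and colimits\<close>

text \<open>The obstacle is that \<open>T X\<close> need not be generated when \<open>X\<close> is,
  so the structure map of an algebra cannot itself be an operation. It has to be recovered from its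
  composites with morphisms \<open>\<omega> : Y \<rightarrow> T X\<close> out of arities, which is
  why the symbols are all Kleisli morphisms between objects of \<open>G\<close>. Recovery rests on
  density of \<open>G\<close> for three functors: the identity, to map out of \<open>T X\<close>;
  \<open>T\<close>, to map out of \<open>T A\<close>; and \<open>T T\<close>, to test associativity.
  Preservation of \<open>M\<close> enters in the third: it makes the image under \<open>T\<close> of
  a directed diagram of \<open>M\<close>-morphisms again such a diagram, so that \<open>T\<close>
  can be applied once more. From this viewpoint a model of the theory is a presheaf on the part of
  the Kleisli category spanned by \<open>G\<close> that extends the hom presheaf of its underlying
  object. Since operations are extensional functions, the correspondence is bijective on objects,
  and the equivalence obtained is an isomorphism of categories over \<open>K\<close>.\<close>

lemma inaccessible_Cinfinite:
  assumes "inaccessible \<kappa>"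
  shows "Cinfinite \<kappa>"
proof
  have "natLeq <o \<kappa>" using assms by (simp add: inaccessible_def)
  from cinfinite_mono[OF ordLess_imp_ordLeq[OF this] natLeq_cinfinite] show "cinfinite \<kappa>" .
qed (use assms in \<open>simp add: inaccessible_def\<close>)

lemma finite_small:
  assumes "inaccessible \<kappa>" "finite A"
  shows "small \<kappa> A"
proof -
  have \<kappa>: "cinfinite \<kappa>" "Card_order \<kappa>" using inaccessible_Cinfinite[OF assms(1)] by auto
  show ?thesis
    unfolding small_def
    by (rule finite_ordLess_infinite[OF card_of_Well_order card_order_on_well_order_on[OF \<kappa>(2)]])
      (use \<kappa>(1) assms(2) in \<open>simp_all add: cinfinite_def Field_card_of\<close>)
qed

lemma small_subset: "small \<kappa> B \<Longrightarrow> A \<subseteq> B \<Longrightarrow> small \<kappa> A"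
  unfolding small_def by (rule ordLeq_ordLess_trans[OF card_of_mono1])

lemma small_image: "small \<kappa> A \<Longrightarrow> small \<kappa> (f ` A)"
  unfolding small_def by (rule ordLeq_ordLess_trans[OF card_of_image])

lemma small_UN:
  assumes "inaccessible \<kappa>" "small \<kappa> I" "\<And>i. i \<in> I \<Longrightarrow> small \<kappa> (A i)"
  shows "small \<kappa> (\<Union>i\<in>I. A i)"
proof -
  have reg: "regularCard \<kappa>" using assms(1) by (simp add: inaccessible_def)
  have A: "\<forall>i\<in>I. |A i| <o \<kappa>" using assms(3) by (simp add: small_def)
  show ?thesis
    unfolding small_def
    by (rule card_of_UNION_ordLess_infinite_Field_regularCard[OF reg
          inaccessible_Cinfinite[OF assms(1)] assms(2)[unfolded small_def] A])
qed

lemma small_Un: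
  assumes "inaccessible \<kappa>" "small \<kappa> A" "small \<kappa> B"
  shows "small \<kappa> (A \<union> B)"
proof -
  have "small \<kappa> (\<Union>X\<in>{A, B}. X)"
    by (rule small_UN[OF assms(1) finite_small[OF assms(1)]]) (use assms(2,3) in auto)
  then show ?thesis by simp
qed

text \<open>A small set is no larger than \<open>Field \<kappa>\<close>, a subset of the universe
  type. The injection later codes Kleisli morphisms tagged with an object as operation symbols of
  type \<open>'u\<close>.\<close>

lemma small_inj_into_universe:
  fixes \<kappa> :: "'u rel"
  assumes "inaccessible \<kappa>" "small \<kappa> A"
  obtains e :: "'b \<Rightarrow> 'u" where "inj_on e A"
proof -
  have "|Field \<kappa>| =o \<kappa>" using assms(1) by (simp add: inaccessible_def card_of_Field_ordIso)
  from ordLess_ordIso_trans[OF assms(2)[unfolded small_def] ordIso_symmetric[OF this]]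
  have "|A| <o |Field \<kappa>|" .
  from ordLeq_transitive[OF ordLess_imp_ordLeq[OF this] card_of_mono1[OF subset_UNIV]]
  have "|A| \<le>o |UNIV :: 'u set|" .
  from iffD2[OF card_of_ordLeq this] show thesis using that by blast
qed

text \<open>Sets in \<open>SetCat\<close> have elements of type \<open>'u\<close>, so a two-element
  test object requires two distinct members of that type.\<close>

lemma universe_two_elements:
  assumes "inaccessible (\<kappa> :: 'u rel)"
  obtains a b :: 'u where "a \<noteq> b"
proof -
  have "infinite (Field \<kappa>)"
    using inaccessible_Cinfinite[OF assms] by (simp add: cinfinite_def)
  then have "infinite (UNIV :: 'u set)" by (rule infinite_super[OF subset_UNIV])
  then obtain b :: 'u where "b \<notin> {undefined}" using ex_new_if_finite[of "{undefined}"] by auto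
  then show thesis using that[of b undefined] by simp
qed

section \<open>Functors on hom-sets and joint epimorphy of colimit legs\<close>

lemma hom_Ob:
  assumes "category C" "f \<in> hom C X Y"
  shows "X \<in> Ob C" "Y \<in> Ob C"
  using assms category.Src_Ob category.Tgt_Ob unfolding hom_def by fast+

lemma functor_hom:
  assumes "is_functor C D F" "f \<in> hom C X Y"
  shows "on_ar F f \<in> hom D (on_ob F X) (on_ob F Y)"
  using assms hom_Ob[of C f X Y] unfolding is_functor_def by blast

lemma functor_Cmp:
  assumes "is_functor C D F" "f \<in> hom C X Y" "g \<in> hom C Y Z"
  shows "on_ar F (g \<cdot>\<^bsub>C\<^esub> f) = on_ar F g \<cdot>\<^bsub>D\<^esub> on_ar F f"
proof -
  have "f \<in> Ar C" "g \<in> Ar C" "Tgt C f = Src C g" using assms(2,3) by (auto simp: hom_def)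
  then show ?thesis using assms(1) unfolding is_functor_def by blast
qed

text \<open>Both \<open>h\<close> and \<open>k\<close> mediate the cocone formed by the legs
  followed by \<open>h\<close>, and mediating morphisms are unique.\<close>

lemma colimit_eqI:
  assumes "is_colimit J C D X c" "category C" "h \<in> hom C X Y" "k \<in> hom C X Y"
    and "\<And>i. i \<in> Ob J \<Longrightarrow> h \<cdot>\<^bsub>C\<^esub> c i = k \<cdot>\<^bsub>C\<^esub> c i"
  shows "h = k"
proof -
  interpret category C by fact
  have c: "cocone J C D X c" using assms(1) by (simp add: is_colimit_def)
  then have J: "category J" and D: "is_functor J C D" by (auto simp: cocone_def is_functor_def)
  have "cocone J C D Y (\<lambda>i. h \<cdot>\<^bsub>C\<^esub> c i)"
    unfolding cocone_def
  proof (intro conjI ballI)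
    show "Y \<in> Ob C" using assms(3) Tgt_Ob by (auto simp: hom_def)
    fix u assume u: "u \<in> Ar J"
    have o: "Src J u \<in> Ob J" "Tgt J u \<in> Ob J"
      using u J by (auto simp: category.Src_Ob category.Tgt_Ob)
    have "on_ar D u \<in> hom C (on_ob D (Src J u)) (on_ob D (Tgt J u))"
      using functor_hom[OF D] u by (simp add: hom_def)
    moreover have "c (Tgt J u) \<in> hom C (on_ob D (Tgt J u)) X"
      "c (Tgt J u) \<cdot>\<^bsub>C\<^esub> on_ar D u = c (Src J u)"
      using c u o by (simp_all add: cocone_def)
    ultimately show "h \<cdot>\<^bsub>C\<^esub> c (Tgt J u) \<cdot>\<^bsub>C\<^esub> on_ar D u = h \<cdot>\<^bsub>C\<^esub> c (Src J u)"
      using Cmp_assoc[OF _ _ assms(3)] by metis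
  qed (use D c assms(3) Cmp_hom in \<open>auto simp: cocone_def\<close>)
  then have "\<exists>!l. l \<in> hom C X Y \<and> (\<forall>i \<in> Ob J. l \<cdot>\<^bsub>C\<^esub> c i = h \<cdot>\<^bsub>C\<^esub> c i)"
    using assms(1) by (simp add: is_colimit_def)
  then obtain l where "\<And>l'. l' \<in> hom C X Y \<Longrightarrow> \<forall>i \<in> Ob J. l' \<cdot>\<^bsub>C\<^esub> c i = h \<cdot>\<^bsub>C\<^esub> c i \<Longrightarrow> l' = l"
    by blast
  from this[of h] this[of k] show ?thesis using assms(3-5) by simp
qed

lemma Ob_poset_cat [simp]: "Ob (poset_cat r) = Field r"
  by (simp add: poset_cat_def)

text \<open>In \<open>SetCat\<close>, colimit cocones are jointly surjective: test against a two-element set.\<close>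

lemma generated_factor:
  fixes K :: "('o, 'u) cat"
  assumes "inaccessible \<kappa>" and gen: "generated_object \<kappa> \<alpha> K M Y"
    and D: "directed_diagram \<kappa> \<alpha> K M r D" and c: "is_colimit (poset_cat r) K D X c"
    and f: "f \<in> hom K Y X"
  shows "\<exists>i \<in> Field r. \<exists>g \<in> hom K Y (on_ob D i). f = c i \<cdot>\<^bsub>K\<^esub> g"
proof (rule ccontr)
  assume no: "\<not> ?thesis"
  obtain a b :: 'u where ab: "a \<noteq> b" using universe_two_elements[OF assms(1)] .
  let ?V = "hom K Y X" and ?B = "{a, b}" and ?S = "SetCat \<kappa>"
  define im where "im g \<longleftrightarrow> (\<exists>i \<in> Field r. \<exists>g' \<in> hom K Y (on_ob D i). g = c i \<cdot>\<^bsub>K\<^esub> g')" for g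
  \<comment> \<open>The characteristic function of the jointly covered part of
    \<open>hom K Y X\<close>, and a constant function. They agree after every leg, because a
    composite with a leg lies in the covered part.\<close>
  let ?h = "(?V, \<lambda>g\<in>?V. if im g then a else b, ?B)" and ?k = "(?V, \<lambda>g\<in>?V. a, ?B)"
  have col: "is_colimit (poset_cat r) ?S (comp_func (hom_func K Y) D)
      (on_ob (hom_func K Y) X) (\<lambda>i. on_ar (hom_func K Y) (c i))"
    using gen D c unfolding generated_object_def preserves_directed_colimits_def by blast
  have S: "category ?S" and V: "small \<kappa> ?V"
    using col by (auto simp: is_colimit_def cocone_def is_functor_def SetCat_def hom_func_def)
  have c_hom: "c i \<in> hom K (on_ob D i) X" if "i \<in> Field r" for i
    using c that by (simp add: is_colimit_def cocone_def)
  have K: "category K" using c by (auto simp: is_colimit_def cocone_def is_functor_def)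
  have B: "small \<kappa> ?B" by (rule finite_small[OF assms(1)]) simp
  have "?h = ?k"
  proof (rule colimit_eqI[OF col S])
    show "?h \<in> hom ?S (on_ob (hom_func K Y) X) ?B" "?k \<in> hom ?S (on_ob (hom_func K Y) X) ?B"
      using V B by (auto simp: hom_def hom_func_def SetCat_def)
    fix i assume i: "i \<in> Ob (poset_cat r)"
    then have ci: "c i \<in> hom K (on_ob D i) X" using c_hom by simp
    then have "c i \<cdot>\<^bsub>K\<^esub> g \<in> ?V" "im (c i \<cdot>\<^bsub>K\<^esub> g)" if "g \<in> hom K Y (on_ob D i)" for g
      using that i category.Cmp_hom[OF K] by (auto simp: im_def)
    moreover have "Src K (c i) = on_ob D i" using ci by (simp add: hom_def)
    ultimately show "?h \<cdot>\<^bsub>?S\<^esub> on_ar (hom_func K Y) (c i) = ?k \<cdot>\<^bsub>?S\<^esub> on_ar (hom_func K Y) (c i)"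
      by (auto simp: SetCat_def hom_func_def compose_def restrict_def fun_eq_iff)
  qed
  \<comment> \<open>At \<open>f\<close>, which by assumption factors through no leg, the two
    functions take the distinct values \<open>b\<close> and \<open>a\<close>.\<close>
  then have "(\<lambda>g\<in>?V. if im g then a else b) f = (\<lambda>g\<in>?V. a) f" by simp
  then show False using f no ab by (auto simp: im_def split: if_splits)
qed

section \<open>Density of a set of objects with respect to a functor\<close>

text \<open>Every functor value \<open>F X\<close> is the colimit of the values \<open>F Y\<close> over the comma category of the
  full subcategory \<open>G\<close> over \<open>X\<close>.\<close>

definition dense_for :: "('o, 'a) cat \<Rightarrow> 'o set \<Rightarrow> ('o, 'a, 'o, 'a) func \<Rightarrow> 'o \<Rightarrow> bool" where
  "dense_for K G F X \<longleftrightarrow> (\<forall>B \<in> Ob K. \<forall>\<phi>.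
     (\<forall>Y \<in> G. \<forall>y \<in> hom K Y X. \<phi> y \<in> hom K (on_ob F Y) B) \<and>
     (\<forall>Y \<in> G. \<forall>Z \<in> G. \<forall>y \<in> hom K Y X. \<forall>g \<in> hom K Z Y. \<phi> (y \<cdot>\<^bsub>K\<^esub> g) = \<phi> y \<cdot>\<^bsub>K\<^esub> on_ar F g) \<longrightarrow>
     (\<exists>!h. h \<in> hom K (on_ob F X) B \<and>
       (\<forall>Y \<in> G. \<forall>y \<in> hom K Y X. h \<cdot>\<^bsub>K\<^esub> on_ar F y = \<phi> y)))"

lemma dense_for_extend:
  assumes "dense_for K G F X" "B \<in> Ob K"
    and "\<And>Y y. Y \<in> G \<Longrightarrow> y \<in> hom K Y X \<Longrightarrow> \<phi> y \<in> hom K (on_ob F Y) B"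
    and "\<And>Y Z y g. Y \<in> G \<Longrightarrow> Z \<in> G \<Longrightarrow> y \<in> hom K Y X \<Longrightarrow> g \<in> hom K Z Y \<Longrightarrow>
      \<phi> (y \<cdot>\<^bsub>K\<^esub> g) = \<phi> y \<cdot>\<^bsub>K\<^esub> on_ar F g"
  shows "\<exists>!h. h \<in> hom K (on_ob F X) B \<and> (\<forall>Y \<in> G. \<forall>y \<in> hom K Y X. h \<cdot>\<^bsub>K\<^esub> on_ar F y = \<phi> y)"
  by (rule assms(1)[unfolded dense_for_def, THEN bspec, OF assms(2), THEN spec, THEN mp])
    (use assms(3,4) in blast)

text \<open>A compatible family, evaluated at the legs \<open>c i\<close>, is a cocone on
  \<open>F D\<close> and so yields \<open>h\<close>. Every other \<open>y\<close> factors through a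
  leg, and compatibility then forces \<open>h\<close> to have the prescribed value there. Uniqueness
  can be checked at the legs alone, because the objects of the diagram lie in
  \<open>G\<close>.\<close>

lemma dense_for_colimit:
  assumes F: "is_functor K K F" and c: "is_colimit J K D X c"
    and Fc: "is_colimit J K (comp_func F D) (on_ob F X) (\<lambda>i. on_ar F (c i))"
    and G: "G \<subseteq> Ob K" "\<And>i. i \<in> Ob J \<Longrightarrow> on_ob D i \<in> G"
    and factor: "\<And>Y y. Y \<in> G \<Longrightarrow> y \<in> hom K Y X \<Longrightarrow>
      \<exists>i \<in> Ob J. \<exists>g \<in> hom K Y (on_ob D i). y = c i \<cdot>\<^bsub>K\<^esub> g"
  shows "dense_for K G F X"
  unfolding dense_for_def
proof (intro ballI allI impI, elim conjE)
  fix B \<phi>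
  assume B: "B \<in> Ob K" and \<phi>: "\<forall>Y \<in> G. \<forall>y \<in> hom K Y X. \<phi> y \<in> hom K (on_ob F Y) B"
    and nat: "\<forall>Y \<in> G. \<forall>Z \<in> G. \<forall>y \<in> hom K Y X. \<forall>g \<in> hom K Z Y.
      \<phi> (y \<cdot>\<^bsub>K\<^esub> g) = \<phi> y \<cdot>\<^bsub>K\<^esub> on_ar F g"
  interpret category K using F by (simp add: is_functor_def)
  have D: "is_functor J K D" and J: "category J"
    using c by (auto simp: is_colimit_def cocone_def is_functor_def)
  have c_hom: "c i \<in> hom K (on_ob D i) X" if "i \<in> Ob J" for i
    using c that by (simp add: is_colimit_def cocone_def)
  have X: "X \<in> Ob K" using c by (simp add: is_colimit_def cocone_def)
  note F_hom = functor_hom[OF F] and F_Cmp = functor_Cmp[OF F]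
  have "cocone J K (comp_func F D) B (\<lambda>i. \<phi> (c i))"
    unfolding cocone_def
  proof (intro conjI ballI)
    show "is_functor J K (comp_func F D)" using Fc by (simp add: is_colimit_def cocone_def)
    fix u assume u: "u \<in> Ar J"
    have o: "Src J u \<in> Ob J" "Tgt J u \<in> Ob J"
      using u J by (auto simp: category.Src_Ob category.Tgt_Ob)
    have Du: "on_ar D u \<in> hom K (on_ob D (Src J u)) (on_ob D (Tgt J u))"
      using functor_hom[OF D] u by (simp add: hom_def)
    have "c (Src J u) = c (Tgt J u) \<cdot>\<^bsub>K\<^esub> on_ar D u"
      using c u by (simp add: is_colimit_def cocone_def)
    then show "\<phi> (c (Tgt J u)) \<cdot>\<^bsub>K\<^esub> on_ar (comp_func F D) u = \<phi> (c (Src J u))"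
      using nat[rule_format, OF G(2)[OF o(2)] G(2)[OF o(1)] c_hom[OF o(2)] Du]
      by (simp add: comp_func_def)
  qed (use B \<phi> G c_hom in \<open>auto simp: comp_func_def\<close>)
  then have "\<exists>!h. h \<in> hom K (on_ob F X) B \<and> (\<forall>i \<in> Ob J. h \<cdot>\<^bsub>K\<^esub> on_ar F (c i) = \<phi> (c i))"
    using Fc by (simp add: is_colimit_def)
  then obtain h where h: "h \<in> hom K (on_ob F X) B"
    "\<And>i. i \<in> Ob J \<Longrightarrow> h \<cdot>\<^bsub>K\<^esub> on_ar F (c i) = \<phi> (c i)"
    by blast
  have "h \<cdot>\<^bsub>K\<^esub> on_ar F y = \<phi> y" if Y: "Y \<in> G" "y \<in> hom K Y X" for Y y
  proof -
    obtain i g where i: "i \<in> Ob J" "g \<in> hom K Y (on_ob D i)" "y = c i \<cdot>\<^bsub>K\<^esub> g"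
      using factor[OF Y] by blast
    have "h \<cdot>\<^bsub>K\<^esub> on_ar F y = (h \<cdot>\<^bsub>K\<^esub> on_ar F (c i)) \<cdot>\<^bsub>K\<^esub> on_ar F g"
      using i(3) F_Cmp[OF i(2) c_hom[OF i(1)]]
        Cmp_assoc[OF F_hom[OF i(2)] F_hom[OF c_hom[OF i(1)]] h(1)] by simp
    also have "\<dots> = \<phi> y"
      using h(2)[OF i(1)] nat[rule_format, OF G(2)[OF i(1)] Y(1) c_hom[OF i(1)] i(2)] i(3) by simp
    finally show ?thesis .
  qed
  then show "\<exists>!h. h \<in> hom K (on_ob F X) B \<and>
      (\<forall>Y \<in> G. \<forall>y \<in> hom K Y X. h \<cdot>\<^bsub>K\<^esub> on_ar F y = \<phi> y)"
  proof (intro ex1I conjI ballI)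
    fix k assume k: "k \<in> hom K (on_ob F X) B \<and>
      (\<forall>Y \<in> G. \<forall>y \<in> hom K Y X. k \<cdot>\<^bsub>K\<^esub> on_ar F y = \<phi> y)"
    show "k = h"
    proof (rule colimit_eqI[OF Fc category_axioms conjunct1[OF k] h(1)])
      fix i assume i: "i \<in> Ob J"
      show "k \<cdot>\<^bsub>K\<^esub> on_ar F (c i) = h \<cdot>\<^bsub>K\<^esub> on_ar F (c i)"
        using k h(2)[OF i] G(2)[OF i] c_hom[OF i] by auto
    qed
  qed (use h in auto)
qed

text \<open>The composites of \<open>h\<close> with the arrows \<open>F y\<close> form a compatible
  family, so \<open>h\<close> and \<open>k\<close> both solve the same extension problem.\<close>

lemma dense_for_ext:
  assumes "dense_for K G F X" "category K" "B \<in> Ob K" "is_functor K K F"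
    and "h \<in> hom K (on_ob F X) B" "k \<in> hom K (on_ob F X) B" "G \<subseteq> Ob K"
    and "\<And>Y y. Y \<in> G \<Longrightarrow> y \<in> hom K Y X \<Longrightarrow> h \<cdot>\<^bsub>K\<^esub> on_ar F y = k \<cdot>\<^bsub>K\<^esub> on_ar F y"
  shows "h = k"
proof -
  interpret category K by fact
  note F_hom = functor_hom[OF assms(4)] and F_Cmp = functor_Cmp[OF assms(4)]
  have 1: "\<forall>Y \<in> G. \<forall>y \<in> hom K Y X. h \<cdot>\<^bsub>K\<^esub> on_ar F y \<in> hom K (on_ob F Y) B"
    using F_hom Cmp_hom assms(5) by blast
  have 2: "h \<cdot>\<^bsub>K\<^esub> on_ar F (y \<cdot>\<^bsub>K\<^esub> g) = (h \<cdot>\<^bsub>K\<^esub> on_ar F y) \<cdot>\<^bsub>K\<^esub> on_ar F g"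
    if "y \<in> hom K Y X" "g \<in> hom K Z Y" for Y Z y g
    using F_Cmp[OF that(2,1)] Cmp_assoc[OF F_hom[OF that(2)] F_hom[OF that(1)] assms(5)] by simp
  have "\<exists>!l. l \<in> hom K (on_ob F X) B \<and>
       (\<forall>Y \<in> G. \<forall>y \<in> hom K Y X. l \<cdot>\<^bsub>K\<^esub> on_ar F y = h \<cdot>\<^bsub>K\<^esub> on_ar F y)"
    by (rule dense_for_extend[OF assms(1,3)]) (use 1 2 in blast)+
  then obtain l where "\<And>l'. l' \<in> hom K (on_ob F X) B \<Longrightarrow>
      \<forall>Y \<in> G. \<forall>y \<in> hom K Y X. l' \<cdot>\<^bsub>K\<^esub> on_ar F y = h \<cdot>\<^bsub>K\<^esub> on_ar F y \<Longrightarrow> l' = l"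
    by blast
  from this[of h] this[of k] show ?thesis using assms(5,6,8) by simp
qed

text \<open>Every generated object is a retract of an object of \<open>\<A>\<close>, and a retract
  is determined up to isomorphism by its idempotent. By local smallness the objects of
  \<open>\<A>\<close> carry only a small set of endomorphisms, so choosing one splitting for each is
  enough.\<close>

lemma small_representatives_of_generated:
  assumes "inaccessible \<kappa>" and K: "category K" and "locally_small \<kappa> K"
    and A: "small \<kappa> \<A>" "\<forall>A \<in> \<A>. generated_object \<kappa> \<alpha> K M A"
      "\<forall>X \<in> Ob K. directed_colimit_of \<kappa> \<alpha> K M \<A> X"
  obtains G where "small \<kappa> G" "\<A> \<subseteq> G" "\<forall>X \<in> G. generated_object \<kappa> \<alpha> K M X"
    "\<forall>X. generated_object \<kappa> \<alpha> K M X \<longrightarrow> (\<exists>Y \<in> G. isomorphic K X Y)"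
proof -
  interpret category K by fact
  \<comment> \<open>\<open>X\<close> splits the idempotent \<open>e\<close>. Being generated is part
    of the condition, so that a chosen splitting object is generated as well.\<close>
  define splits where "splits e X \<longleftrightarrow> generated_object \<kappa> \<alpha> K M X \<and>
    (\<exists>p s A. A \<in> \<A> \<and> p \<in> hom K A X \<and> s \<in> hom K X A \<and> p \<cdot>\<^bsub>K\<^esub> s = One K X \<and> s \<cdot>\<^bsub>K\<^esub> p = e)"
    for e X
  \<comment> \<open>\<open>\<A>\<close> is kept as a subset, because density of \<open>G\<close>
    will use colimits of diagrams with objects in \<open>\<A>\<close>.\<close>
  define G where "G = \<A> \<union> (\<lambda>e. Eps (splits e)) ` {e \<in> (\<Union>A\<in>\<A>. hom K A A). \<exists>X. splits e X}"
  have splits_Eps: "splits e (Eps (splits e))" if "splits e X" for e X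
    using that by (rule someI)
  have 1: "\<exists>e. splits e X" if X: "generated_object \<kappa> \<alpha> K M X" for X
  proof -
    have XO: "X \<in> Ob K" using X by (simp add: generated_object_def)
    then obtain r D c where D: "directed_diagram \<kappa> \<alpha> K M r D" "\<forall>i \<in> Field r. on_ob D i \<in> \<A>"
      and c: "is_colimit (poset_cat r) K D X c"
      using A(3) by (auto simp: directed_colimit_of_def)
    \<comment> \<open>Factoring the identity of \<open>X\<close> through a leg exhibits
      \<open>X\<close> as a retract of an object of the diagram; the idempotent is \<open>s\<close>
      after that leg.\<close>
    obtain i s where i: "i \<in> Field r" "s \<in> hom K X (on_ob D i)" "One K X = c i \<cdot>\<^bsub>K\<^esub> s"
      using generated_factor[OF assms(1) X D(1) c One_hom[OF XO]] by blast
    have "c i \<in> hom K (on_ob D i) X"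
      using c i(1) by (simp add: is_colimit_def cocone_def)
    then have "splits (s \<cdot>\<^bsub>K\<^esub> c i) X"
      unfolding splits_def using X D(2)[rule_format, OF i(1)] i(2) i(3)[symmetric] by blast
    then show ?thesis ..
  qed
  have 2: "isomorphic K X X'" if XX': "splits e X" "splits e X'" for e X X'
  proof -
    obtain p s A where p: "p \<in> hom K A X" "s \<in> hom K X A" "p \<cdot>\<^bsub>K\<^esub> s = One K X" "s \<cdot>\<^bsub>K\<^esub> p = e"
      using XX'(1) unfolding splits_def by blast
    obtain p' s' A' where p': "p' \<in> hom K A' X'" "s' \<in> hom K X' A'" "p' \<cdot>\<^bsub>K\<^esub> s' = One K X'"
      "s' \<cdot>\<^bsub>K\<^esub> p' = e"
      using XX'(2) unfolding splits_def by blast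
    have "e \<in> hom K A A" "e \<in> hom K A' A'"
      using Cmp_hom[OF p(1,2)] Cmp_hom[OF p'(1,2)] p(4) p'(4) by simp_all
    \<comment> \<open>The two splittings share the arrow \<open>e\<close>, and an arrow has only one
      source.\<close>
    then have [simp]: "A' = A" by (simp add: hom_def)
    note p' = p'[simplified]
    \<comment> \<open>Stated for two arbitrary splittings, so that exchanging them gives the other
      of the two inverse laws.\<close>
    have 3: "(q \<cdot>\<^bsub>K\<^esub> t') \<cdot>\<^bsub>K\<^esub> (q' \<cdot>\<^bsub>K\<^esub> t) = One K Z"
      if "q \<in> hom K A Z" "t \<in> hom K Z A" "q \<cdot>\<^bsub>K\<^esub> t = One K Z" "t \<cdot>\<^bsub>K\<^esub> q = e"
        "q' \<in> hom K A Z'" "t' \<in> hom K Z' A" "t' \<cdot>\<^bsub>K\<^esub> q' = e" for q t q' t' Z Z'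
    proof -
      have "(q \<cdot>\<^bsub>K\<^esub> t') \<cdot>\<^bsub>K\<^esub> (q' \<cdot>\<^bsub>K\<^esub> t) = ((q \<cdot>\<^bsub>K\<^esub> t') \<cdot>\<^bsub>K\<^esub> q') \<cdot>\<^bsub>K\<^esub> t"
        by (rule Cmp_assoc[OF that(2) that(5) Cmp_hom[OF that(6) that(1)]])
      also have "\<dots> = (q \<cdot>\<^bsub>K\<^esub> (t \<cdot>\<^bsub>K\<^esub> q)) \<cdot>\<^bsub>K\<^esub> t"
        using Cmp_assoc[OF that(5,6,1)] that(4,7) by simp
      also have "\<dots> = ((q \<cdot>\<^bsub>K\<^esub> t) \<cdot>\<^bsub>K\<^esub> q) \<cdot>\<^bsub>K\<^esub> t"
        using Cmp_assoc[OF that(1,2,1)] by simp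
      also have "\<dots> = One K Z" using that(3) One_left[OF that(1)] by simp
      finally show ?thesis .
    qed
    note hom = Cmp_hom[OF p(2) p'(1)] Cmp_hom[OF p'(2) p(1)]
    have "(p \<cdot>\<^bsub>K\<^esub> s') \<cdot>\<^bsub>K\<^esub> (p' \<cdot>\<^bsub>K\<^esub> s) = One K X" "(p' \<cdot>\<^bsub>K\<^esub> s) \<cdot>\<^bsub>K\<^esub> (p \<cdot>\<^bsub>K\<^esub> s') = One K X'"
      using 3[OF p p'(1,2,4)] 3[OF p' p(1,2,4)] by simp_all
    then show ?thesis using hom unfolding isomorphic_def iso_arrow_def
      by (intro bexI[of _ "p' \<cdot>\<^bsub>K\<^esub> s"] conjI bexI[of _ "p \<cdot>\<^bsub>K\<^esub> s'"]) (simp_all add: hom_def)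
  qed
  show thesis
  proof (rule that[of G])
    have "small \<kappa> (hom K A A)" if "A \<in> \<A>" for A
      using that A(2) assms(3) by (auto simp: locally_small_def generated_object_def)
    then have "small \<kappa> (\<Union>A\<in>\<A>. hom K A A)" by (intro small_UN assms(1) A(1))
    then have "small \<kappa> {e \<in> (\<Union>A\<in>\<A>. hom K A A). \<exists>X. splits e X}"
      by (rule small_subset) (rule Collect_restrict)
    then show "small \<kappa> G"
      unfolding G_def by (rule small_Un[OF assms(1) A(1) small_image])
    show "\<forall>X \<in> G. generated_object \<kappa> \<alpha> K M X"
    proof
      fix X assume "X \<in> G"
      then consider "X \<in> \<A>" | e Y where "splits e Y" "X = Eps (splits e)"
        unfolding G_def by blast
      then show "generated_object \<kappa> \<alpha> K M X"
      proof cases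
        case 2
        then have "splits e X" using splits_Eps by simp
        then show ?thesis by (simp add: splits_def)
      qed (use A(2) in simp)
    qed
    show "\<forall>X. generated_object \<kappa> \<alpha> K M X \<longrightarrow> (\<exists>Y \<in> G. isomorphic K X Y)"
    proof (intro allI impI)
      fix X assume "generated_object \<kappa> \<alpha> K M X"
      then obtain e where e: "splits e X" using 1 by blast
      then obtain p s A where "A \<in> \<A>" "p \<in> hom K A X" "s \<in> hom K X A" "s \<cdot>\<^bsub>K\<^esub> p = e"
        unfolding splits_def by blast
      then have "e \<in> (\<Union>A\<in>\<A>. hom K A A)" using Cmp_hom[of p A X s A] by auto
      then have "Eps (splits e) \<in> G" using e unfolding G_def by auto
      then show "\<exists>Y \<in> G. isomorphic K X Y" using 2[OF e splits_Eps[OF e]] by blast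
    qed
  qed (simp add: G_def)
qed

section \<open>Equations between terms\<close>

text \<open>A symbol carries its arity, a variable has a source and a target, and a composite
  inherits its arity from its parts.\<close>

lemma raw_term_of_unique:
  assumes "raw_term_of K t X Y p" "raw_term_of K t X' Y' p"
  shows "X = X' \<and> Y = Y'"
  using assms
proof (induction arbitrary: X' Y' rule: raw_term_of.induct)
  case (Sym w X Y)
  from Sym(3) show ?case by cases (use Sym in auto)
next
  case (Var X Y f)
  from Var(4) show ?case by cases (use Var in \<open>auto simp: hom_def\<close>)
next
  case (App X Y p Z q)
  from App(5) show ?case by cases (blast dest: App(3,4))
qed

definition term_class ::
  "('o, 'a) cat \<Rightarrow> ('o, 'w) op_type \<Rightarrow> 'o \<Rightarrow> 'o \<Rightarrow> ('w, 'a) raw_term \<Rightarrow> ('w, 'a) raw_term set" where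
  "term_class K t X Y p = {q. term_eq K t X Y p q}"

text \<open>The raw equations carry their arity because \<open>term_eq\<close>, and with it the
  class of a term, is indexed by arities.\<close>

definition class_equations ::
  "('o, 'a) cat \<Rightarrow> ('o, 'w) op_type \<Rightarrow> ('o \<times> 'o \<times> ('w, 'a) raw_term \<times> ('w, 'a) raw_term) set \<Rightarrow>
    (('w, 'a) raw_term set \<times> ('w, 'a) raw_term set) set" where
  "class_equations K t R = (\<lambda>(X, Y, p, q). (term_class K t X Y p, term_class K t X Y q)) ` R"

definition well_formed_equations ::
  "('o, 'a) cat \<Rightarrow> ('o, 'w) op_type \<Rightarrow> ('o \<times> 'o \<times> ('w, 'a) raw_term \<times> ('w, 'a) raw_term) set \<Rightarrow> bool"
  where
  "well_formed_equations K t R \<longleftrightarrow>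
    (\<forall>(X, Y, p, q) \<in> R. raw_term_of K t X Y p \<and> raw_term_of K t X Y q)"

lemma term_class_terms: "raw_term_of K t X Y p \<Longrightarrow> term_class K t X Y p \<in> terms K t X Y"
  using quotientI[of p "{p. raw_term_of K t X Y p}" "{(p, q). term_eq K t X Y p q}"]
  by (simp add: term_class_def terms_def Image_def)

text \<open>\<open>satisfies\<close> ranges over all arities whose \<open>terms\<close> contain the
  given class. A class contains its representative, whose arity is determined, so only the intended
  arity occurs.\<close>

lemma term_class_terms_unique:
  assumes "category K" "is_op_type \<kappa> K t" "raw_term_of K t X Y p"
    and "term_class K t X Y p \<in> terms K t X' Y'"
  shows "X' = X" "Y' = Y"
proof -
  obtain p' where "term_class K t X Y p = {q. term_eq K t X' Y' p' q}"
    using assms(4) unfolding terms_def by (auto elim!: quotientE simp: Image_def)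
  moreover have "p \<in> term_class K t X Y p"
    using assms(3) by (simp add: term_class_def term_eq.refl)
  ultimately have "term_eq K t X' Y' p' p" by simp
  then have "raw_term_of K t X' Y' p" using term_eq_raw_term[OF assms(1,2)] by blast
  from raw_term_of_unique[OF this assms(3)] show "X' = X" "Y' = Y" by simp_all
qed

lemma interp_term_class:
  assumes "category K" "is_op_type \<kappa> K t" "(A, ops) \<in> algebras K t"
    and "raw_term_of K t X Y p" "a \<in> hom K X A"
  shows "interp K ops (term_class K t X Y p) a = raw_interp K ops p a"
proof -
  have "p \<in> term_class K t X Y p"
    using assms(4) by (simp add: term_class_def term_eq.refl)
  from someI[of "\<lambda>q. q \<in> term_class K t X Y p", OF this]
  have "term_eq K t X Y p (SOME q. q \<in> term_class K t X Y p)"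
    unfolding term_class_def by (rule CollectD)
  from term_eq_interp[OF assms(1-3) this assms(5)] show ?thesis by (simp add: interp_def)
qed

lemma equational_theory_class_equations:
  assumes "is_op_type \<kappa> K t" "well_formed_equations K t R"
  shows "equational_theory K t (class_equations K t R)"
  unfolding equational_theory_def
proof
  fix e assume "e \<in> class_equations K t R"
  then obtain X Y p q where e: "(X, Y, p, q) \<in> R" "e = (term_class K t X Y p, term_class K t X Y q)"
    by (auto simp: class_equations_def)
  then have pq: "raw_term_of K t X Y p" "raw_term_of K t X Y q"
    using assms(2) by (auto simp: well_formed_equations_def)
  show "\<exists>X \<in> obs t. \<exists>Y \<in> obs t. e \<in> terms K t X Y \<times> terms K t X Y"
    using raw_term_obs[OF assms(1) pq(1)] pq
    by (intro bexI[of _ X] bexI[of _ Y]) (simp_all add: e(2) term_class_terms)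
qed

text \<open>Removes quotients and choice of representatives from satisfaction; from here on,
  equations are checked on raw terms.\<close>

lemma satisfies_class_equations:
  assumes K: "category K" and t: "is_op_type \<kappa> K t" and A: "(A, ops) \<in> algebras K t"
    and R: "well_formed_equations K t R"
  shows "satisfies K t (class_equations K t R) (A, ops) \<longleftrightarrow>
    (\<forall>(X, Y, p, q) \<in> R. \<forall>a \<in> hom K X A. raw_interp K ops p a = raw_interp K ops q a)"
    (is "?L \<longleftrightarrow> ?R")
proof
  assume L: ?L
  show ?R
  proof clarify
    fix X Y p q a assume R': "(X, Y, p, q) \<in> R" and a: "a \<in> hom K X A"
    have p: "raw_term_of K t X Y p" and q: "raw_term_of K t X Y q"
      using R R' by (auto simp: well_formed_equations_def)
    have E: "(term_class K t X Y p, term_class K t X Y q) \<in> class_equations K t R"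
      unfolding class_equations_def using R' by force
    have "interp K ops (term_class K t X Y p) a = interp K ops (term_class K t X Y q) a"
      using bspec[OF L[unfolded satisfies_def prod.case] E] a
        term_class_terms[OF p] term_class_terms[OF q] raw_term_obs[OF t p] by auto
    then show "raw_interp K ops p a = raw_interp K ops q a"
      by (simp add: interp_term_class[OF K t A _ a] p q)
  qed
next
  assume Rt: ?R
  show ?L
    unfolding satisfies_def class_equations_def
  proof clarify
    fix X Y p q X' Y' a
    assume R': "(X, Y, p, q) \<in> R" and P: "term_class K t X Y p \<in> terms K t X' Y'"
      and a: "a \<in> hom K X' A"
    have p: "raw_term_of K t X Y p" and q: "raw_term_of K t X Y q"
      using R R' by (auto simp: well_formed_equations_def)
    have a: "a \<in> hom K X A" using a term_class_terms_unique(1)[OF K t p P] by simp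
    have "raw_interp K ops p a = raw_interp K ops q a" using Rt R' a by fast
    then show "interp K ops (term_class K t X Y p) a = interp K ops (term_class K t X Y q) a"
      by (simp add: interp_term_class[OF K t A _ a] p q)
  qed
qed

section \<open>Equivalences of concrete categories\<close>

lemma is_functorI:
  assumes "category C" "category D" "\<And>X. X \<in> Ob C \<Longrightarrow> on_ob F X \<in> Ob D"
    and "\<And>f X Y. f \<in> hom C X Y \<Longrightarrow> on_ar F f \<in> hom D (on_ob F X) (on_ob F Y)"
    and "\<And>X. X \<in> Ob C \<Longrightarrow> on_ar F (One C X) = One D (on_ob F X)"
    and "\<And>f g X Y Z. f \<in> hom C X Y \<Longrightarrow> g \<in> hom C Y Z \<Longrightarrow>
      on_ar F (g \<cdot>\<^bsub>C\<^esub> f) = on_ar F g \<cdot>\<^bsub>D\<^esub> on_ar F f"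
  shows "is_functor C D F"
  unfolding is_functor_def using assms by (simp add: hom_def)

lemma structured_cat_simps [simp]:
  "Ob (structured_cat K S H) = S"
  "One (structured_cat K S H) x = (x, One K (fst x), x)"
  "(y', g, z) \<cdot>\<^bsub>structured_cat K S H\<^esub> (x, f, y) = (x, g \<cdot>\<^bsub>K\<^esub> f, z)"
  by (simp_all add: structured_cat_def)

lemma Ar_structured_cat [simp]:
  "(x, h, y) \<in> Ar (structured_cat K S H) \<longleftrightarrow>
    x \<in> S \<and> y \<in> S \<and> h \<in> hom K (fst x) (fst y) \<and> H x y h"
  by (simp add: structured_cat_def)

lemma hom_structured_cat:
  "u \<in> hom (structured_cat K S H) x y \<longleftrightarrow> x \<in> S \<and> y \<in> S \<and>
    (\<exists>h. u = (x, h, y) \<and> h \<in> hom K (fst x) (fst y) \<and> H x y h)"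
  by (auto simp: hom_def structured_cat_def)

lemma category_structured_cat:
  assumes "category K" and "\<And>x. x \<in> S \<Longrightarrow> fst x \<in> Ob K"
    and "\<And>x. x \<in> S \<Longrightarrow> H x x (One K (fst x))"
    and "\<And>x y z f g. x \<in> S \<Longrightarrow> y \<in> S \<Longrightarrow> z \<in> S \<Longrightarrow> f \<in> hom K (fst x) (fst y) \<Longrightarrow>
      g \<in> hom K (fst y) (fst z) \<Longrightarrow> H x y f \<Longrightarrow> H y z g \<Longrightarrow> H x z (g \<cdot>\<^bsub>K\<^esub> f)"
  shows "category (structured_cat K S H)"
proof -
  interpret category K by fact
  show ?thesis
  proof
    fix f assume "f \<in> Ar (structured_cat K S H)"
    then show "Src (structured_cat K S H) f \<in> Ob (structured_cat K S H)"
      "Tgt (structured_cat K S H) f \<in> Ob (structured_cat K S H)"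
      by (auto simp: structured_cat_def)
  next
    fix x assume "x \<in> Ob (structured_cat K S H)"
    then show "One (structured_cat K S H) x \<in> hom (structured_cat K S H) x x"
      using assms(2,3) One_hom by (simp add: hom_structured_cat)
  next
    fix x y f assume "f \<in> hom (structured_cat K S H) x y"
    then show "One (structured_cat K S H) y \<cdot>\<^bsub>structured_cat K S H\<^esub> f = f"
      "f \<cdot>\<^bsub>structured_cat K S H\<^esub> One (structured_cat K S H) x = f"
      using One_left One_right by (auto simp: hom_structured_cat)
  next
    fix x y z f g
    assume f: "f \<in> hom (structured_cat K S H) x y" and g: "g \<in> hom (structured_cat K S H) y z"
    then obtain f' g' where f': "f = (x, f', y)" "f' \<in> hom K (fst x) (fst y)" "H x y f'"
      and g': "g = (y, g', z)" "g' \<in> hom K (fst y) (fst z)" "H y z g'"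
      and S: "x \<in> S" "y \<in> S" "z \<in> S"
      by (auto simp: hom_structured_cat)
    show "g \<cdot>\<^bsub>structured_cat K S H\<^esub> f \<in> hom (structured_cat K S H) x z"
      using assms(4)[OF S f'(2) g'(2) f'(3) g'(3)] Cmp_hom[OF f'(2) g'(2)] S
      by (simp add: hom_structured_cat f'(1) g'(1))
    fix h w assume "h \<in> hom (structured_cat K S H) z w"
    then obtain h' where "h = (z, h', w)" "h' \<in> hom K (fst z) (fst w)"
      by (auto simp: hom_structured_cat)
    then show "h \<cdot>\<^bsub>structured_cat K S H\<^esub> (g \<cdot>\<^bsub>structured_cat K S H\<^esub> f) =
        h \<cdot>\<^bsub>structured_cat K S H\<^esub> g \<cdot>\<^bsub>structured_cat K S H\<^esub> f"
      using Cmp_assoc[OF f'(2) g'(2)] by (simp add: f'(1) g'(1))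
  qed
qed

lemma concrete_functor_structured_cat:
  assumes S: "category (structured_cat K S H)" and S': "category (structured_cat K S' H')"
    and K: "category K"
    and \<phi>: "\<And>x. x \<in> S \<Longrightarrow> \<phi> x \<in> S' \<and> fst (\<phi> x) = fst x"
    and H: "\<And>x y h. x \<in> S \<Longrightarrow> y \<in> S \<Longrightarrow> h \<in> hom K (fst x) (fst y) \<Longrightarrow> H x y h \<Longrightarrow> H' (\<phi> x) (\<phi> y) h"
  shows "concrete_functor (structured_cat K S H) forgetful (structured_cat K S' H') forgetful
    \<lparr>on_ob = \<phi>, on_ar = (\<lambda>(x, h, y). (\<phi> x, h, \<phi> y))\<rparr>"
  unfolding concrete_functor_def
proof (intro conjI ballI)
  show "is_functor (structured_cat K S H) (structured_cat K S' H')
    \<lparr>on_ob = \<phi>, on_ar = (\<lambda>(x, h, y). (\<phi> x, h, \<phi> y))\<rparr>"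
    by (rule is_functorI[OF S S']) (use \<phi> H in \<open>auto simp: hom_structured_cat\<close>)
qed (use \<phi> in \<open>auto simp: forgetful_def\<close>)

lemma is_functor_forgetful:
  assumes "category (structured_cat K S H)" "category K" "\<And>x. x \<in> S \<Longrightarrow> fst x \<in> Ob K"
  shows "is_functor (structured_cat K S H) K forgetful"
  by (rule is_functorI[OF assms(1,2)]) (use assms(3) in \<open>auto simp: forgetful_def hom_structured_cat\<close>)

text \<open>\<open>F\<close> need not equal \<open>id_func\<close> as a record, since its values off
  the carriers of \<open>A\<close> are arbitrary. The identities are nevertheless invertible 2-cells
  in both directions.\<close>

lemma nat_iso_identity:
  assumes F: "is_functor A A F" and ob: "\<And>X. X \<in> Ob A \<Longrightarrow> on_ob F X = X"
    and ar: "\<And>f. f \<in> Ar A \<Longrightarrow> on_ar F f = f"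
  shows "nat_iso A A id_func F (One A)" "nat_iso A A F id_func (One A)"
proof -
  interpret category A using F by (simp add: is_functor_def)
  have id: "is_functor A A id_func"
    using category_axioms by (auto simp: is_functor_def id_func_def)
  have iso: "iso_arrow A (One A X)" if "X \<in> Ob A" for X
    using One_hom[OF that] One_left[OF One_hom[OF that]]
    unfolding iso_arrow_def by (auto simp: hom_def intro!: bexI[of _ "One A X"])
  have nat: "One A (Tgt A f) \<cdot>\<^bsub>A\<^esub> f = f \<cdot>\<^bsub>A\<^esub> One A (Src A f)" if "f \<in> Ar A" for f
    using One_left[of f] One_right[of f] that by (simp add: hom_def)
  show "nat_iso A A id_func F (One A)" "nat_iso A A F id_func (One A)"
    using F id iso nat One_hom ob ar unfolding nat_iso_def nat_transf_def
    by (simp_all add: id_func_def)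
qed

lemma is_functor_comp_func:
  assumes "is_functor A B F" "is_functor B C G"
  shows "is_functor A C (comp_func G F)"
proof (rule is_functorI)
  show "category A" "category C" using assms by (simp_all add: is_functor_def)
  fix X Y Z f g assume f: "f \<in> hom A X Y"
  then show "on_ar (comp_func G F) f \<in> hom C (on_ob (comp_func G F) X) (on_ob (comp_func G F) Y)"
    using functor_hom[OF assms(2) functor_hom[OF assms(1)]] by (simp add: comp_func_def)
  assume g: "g \<in> hom A Y Z"
  show "on_ar (comp_func G F) (g \<cdot>\<^bsub>A\<^esub> f) = on_ar (comp_func G F) g \<cdot>\<^bsub>C\<^esub> on_ar (comp_func G F) f"
    using functor_Cmp[OF assms(1) f g]
      functor_Cmp[OF assms(2) functor_hom[OF assms(1) f] functor_hom[OF assms(1) g]]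
    by (simp add: comp_func_def)
qed (use assms in \<open>auto simp: comp_func_def is_functor_def\<close>)

text \<open>A bijection of structured objects that fixes underlying objects and respects the hom
  conditions is an isomorphism over \<open>K\<close>, with inverse \<open>inv_into\<close>. The
  closure conditions are demanded on one side only, as they transfer along the bijection.\<close>

lemma concretely_equivalent_structured_cat:
  assumes K: "category K" and S: "\<And>x. x \<in> S \<Longrightarrow> fst x \<in> Ob K"
    and One: "\<And>x. x \<in> S \<Longrightarrow> H x x (One K (fst x))"
    and Cmp: "\<And>x y z f g. x \<in> S \<Longrightarrow> y \<in> S \<Longrightarrow> z \<in> S \<Longrightarrow> f \<in> hom K (fst x) (fst y) \<Longrightarrow>
      g \<in> hom K (fst y) (fst z) \<Longrightarrow> H x y f \<Longrightarrow> H y z g \<Longrightarrow> H x z (g \<cdot>\<^bsub>K\<^esub> f)"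
    and bij: "bij_betw \<phi> S S'" and fst: "\<And>x. x \<in> S \<Longrightarrow> fst (\<phi> x) = fst x"
    and H: "\<And>x y h. x \<in> S \<Longrightarrow> y \<in> S \<Longrightarrow> h \<in> hom K (fst x) (fst y) \<Longrightarrow>
      H' (\<phi> x) (\<phi> y) h \<longleftrightarrow> H x y h"
  shows "concretely_equivalent K (structured_cat K S H) forgetful (structured_cat K S' H') forgetful"
proof -
  let ?A = "structured_cat K S H" and ?B = "structured_cat K S' H'"
  define \<psi> where "\<psi> = inv_into S \<phi>"
  define F where "F = \<lparr>on_ob = \<phi>, on_ar = (\<lambda>(x, h :: 'b, y). (\<phi> x, h, \<phi> y))\<rparr>"
  define G where "G = \<lparr>on_ob = \<psi>, on_ar = (\<lambda>(x, h :: 'b, y). (\<psi> x, h, \<psi> y))\<rparr>"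
  have \<phi>: "\<phi> x \<in> S'" "\<psi> (\<phi> x) = x" if "x \<in> S" for x
    using bij that by (auto simp: \<psi>_def bij_betw_def)
  have \<psi>: "\<psi> y \<in> S" "\<phi> (\<psi> y) = y" "fst (\<psi> y) = fst y" if "y \<in> S'" for y
  proof -
    show 1: "\<psi> y \<in> S" "\<phi> (\<psi> y) = y"
      using bij that by (auto simp: \<psi>_def bij_betw_def inv_into_into f_inv_into_f)
    show "fst (\<psi> y) = fst y" using fst[OF 1(1)] 1(2) by simp
  qed
  have H': "H' x y h \<longleftrightarrow> H (\<psi> x) (\<psi> y) h"
    if "x \<in> S'" "y \<in> S'" "h \<in> hom K (fst x) (fst y)" for x y h
    using H[of "\<psi> x" "\<psi> y" h] \<psi> that by simp
  have A: "category ?A" by (rule category_structured_cat) (fact K S One Cmp)+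
  interpret category K by fact
  have S': "fst x \<in> Ob K" if "x \<in> S'" for x using S[OF \<psi>(1)] \<psi>(3) that by simp
  have B: "category ?B"
  proof (rule category_structured_cat[OF K S'])
    fix x y z f g
    assume *: "x \<in> S'" "y \<in> S'" "z \<in> S'" "f \<in> hom K (fst x) (fst y)" "g \<in> hom K (fst y) (fst z)"
      "H' x y f" "H' y z g"
    show "H' x z (g \<cdot>\<^bsub>K\<^esub> f)"
      using Cmp[of "\<psi> x" "\<psi> y" "\<psi> z" f g] * \<psi> H' Cmp_hom[OF *(4,5)] by simp
  next
    fix x assume x: "x \<in> S'"
    show "H' x x (One K (fst x))"
      using One[OF \<psi>(1)[OF x]] H'[OF x x One_hom[OF S'[OF x]]] \<psi>(3)[OF x] by simp
  qed
  have F: "concrete_functor ?A forgetful ?B forgetful F"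
    unfolding F_def by (rule concrete_functor_structured_cat[OF A B K]) (use \<phi> fst H in auto)
  have G: "concrete_functor ?B forgetful ?A forgetful G"
    unfolding G_def by (rule concrete_functor_structured_cat[OF B A K]) (use \<psi> H' in auto)
  have GF: "is_functor ?A ?A (comp_func G F)" and FG: "is_functor ?B ?B (comp_func F G)"
    using F G is_functor_comp_func unfolding concrete_functor_def by blast+
  have GF_id: "nat_iso ?A ?A id_func (comp_func G F) (One ?A)"
    by (rule nat_iso_identity(1)[OF GF])
      (auto simp: comp_func_def F_def G_def \<phi>)
  have FG_id: "nat_iso ?B ?B (comp_func F G) id_func (One ?B)"
    by (rule nat_iso_identity(2)[OF FG])
      (auto simp: comp_func_def F_def G_def \<psi>)
  have One_A: "\<forall>x \<in> Ob ?A. on_ar forgetful (One ?A x) = One K (on_ob forgetful x)"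
    and One_B: "\<forall>x \<in> Ob ?B. on_ar forgetful (One ?B x) = One K (on_ob forgetful x)"
    by (auto simp: forgetful_def)
  show ?thesis
    unfolding concretely_equivalent_def
    using is_functor_forgetful[OF A K S] is_functor_forgetful[OF B K S'] F G GF_id FG_id One_A One_B
    by blast
qed

section \<open>The Kleisli theory of a monad\<close>

text \<open>Neither \<open>M\<close> nor the degree of directedness appears: what the construction
  takes from them is condensed into the three density assumptions. \<open>enc\<close> codes tagged
  Kleisli morphisms as elements of \<open>'u\<close>.\<close>

locale kleisli_arities = category K for K :: "('o, 'u) cat" (structure) +
  fixes \<kappa> :: "'u rel" and T :: "('o, 'u, 'o, 'u) func" and \<eta> m :: "'o \<Rightarrow> 'u"
    and G :: "'o set" and enc :: "'o \<times> 'u \<Rightarrow> 'u"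
  assumes locally_small: "locally_small \<kappa> K"
    and monad: "monad K T \<eta> m"
    and G_Ob: "G \<subseteq> Ob K"
    and dense_id: "X \<in> Ob K \<Longrightarrow> dense_for K G id_func X"
    and dense_T: "X \<in> Ob K \<Longrightarrow> dense_for K G T X"
    and dense_TT: "X \<in> Ob K \<Longrightarrow> dense_for K G (comp_func T T) X"
    and inj_enc: "inj_on enc {(X, \<omega>). X \<in> G \<and> \<omega> \<in> Ar K \<and> Src K \<omega> \<in> G \<and> Tgt K \<omega> = on_ob T X}"
begin

text \<open>The operation symbols of arity \<open>(X, Y)\<close> are the Kleisli morphisms from \<open>Y\<close> to \<open>X\<close>, tagged by
  \<open>X\<close> since \<open>on_ob T\<close> need not be injective.\<close>

definition kleisli_arrows :: "('o \<times> 'u) set" where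
  "kleisli_arrows = {(X, \<omega>). X \<in> G \<and> \<omega> \<in> Ar K \<and> Src K \<omega> \<in> G \<and> Tgt K \<omega> = on_ob T X}"

definition arrow_of :: "'u \<Rightarrow> 'u" where
  "arrow_of w = snd (inv_into kleisli_arrows enc w)"

definition kleisli_type :: "('o, 'u) op_type" where
  "kleisli_type = \<lparr>obs = G, syms = enc ` kleisli_arrows,
     arity = (\<lambda>w. (fst (inv_into kleisli_arrows enc w), Src K (arrow_of w)))\<rparr>"

abbreviation "op_sym X \<omega> \<equiv> enc (X, \<omega>)"

lemma obs_kleisli_type [simp]: "obs kleisli_type = G"
  by (simp add: kleisli_type_def)

lemma G_ObD: "X \<in> G \<Longrightarrow> X \<in> Ob K"
  using G_Ob by blast

lemma op_sym:
  assumes "X \<in> G" "Y \<in> G" "\<omega> \<in> hom K Y (on_ob T X)"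
  shows "op_sym X \<omega> \<in> syms kleisli_type" "arity kleisli_type (op_sym X \<omega>) = (X, Y)"
    "arrow_of (op_sym X \<omega>) = \<omega>"
proof -
  have 1: "(X, \<omega>) \<in> kleisli_arrows" using assms by (simp add: kleisli_arrows_def hom_def)
  then have "inv_into kleisli_arrows enc (op_sym X \<omega>) = (X, \<omega>)"
    using inj_enc by (simp add: kleisli_arrows_def inv_into_f_f)
  then show "op_sym X \<omega> \<in> syms kleisli_type" "arity kleisli_type (op_sym X \<omega>) = (X, Y)"
    "arrow_of (op_sym X \<omega>) = \<omega>"
    using 1 assms(3) by (simp_all add: kleisli_type_def arrow_of_def hom_def)
qed

lemma symE:
  assumes "w \<in> syms kleisli_type"
  obtains X Y \<omega> where "w = op_sym X \<omega>" "X \<in> G" "Y \<in> G" "\<omega> \<in> hom K Y (on_ob T X)"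
  using assms that by (auto simp: kleisli_type_def kleisli_arrows_def hom_def)

lemma T_functor: "is_functor K K T"
  using monad by (simp add: monad_def nat_transf_def)

lemmas T_hom = functor_hom[OF T_functor]
lemmas T_Cmp = functor_Cmp[OF T_functor]

lemma T_Ob: "X \<in> Ob K \<Longrightarrow> on_ob T X \<in> Ob K"
  using T_functor by (simp add: is_functor_def)

lemma T_One: "X \<in> Ob K \<Longrightarrow> on_ar T (One K X) = One K (on_ob T X)"
  using T_functor by (simp add: is_functor_def)

lemma \<eta>_hom: "X \<in> Ob K \<Longrightarrow> \<eta> X \<in> hom K X (on_ob T X)"
  using monad by (simp add: monad_def nat_transf_def id_func_def)

lemma m_hom: "X \<in> Ob K \<Longrightarrow> m X \<in> hom K (on_ob T (on_ob T X)) (on_ob T X)"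
  using monad by (simp add: monad_def nat_transf_def comp_func_def)

lemma \<eta>_natural: "f \<in> hom K X Y \<Longrightarrow> \<eta> Y \<cdot> f = on_ar T f \<cdot> \<eta> X"
  using monad by (auto simp: monad_def nat_transf_def id_func_def hom_def)

lemma m_natural: "f \<in> hom K X Y \<Longrightarrow> m Y \<cdot> on_ar T (on_ar T f) = on_ar T f \<cdot> m X"
  using monad by (auto simp: monad_def nat_transf_def comp_func_def hom_def)

lemma m_T\<eta>: "X \<in> Ob K \<Longrightarrow> m X \<cdot> on_ar T (\<eta> X) = One K (on_ob T X)"
  and m_\<eta>T: "X \<in> Ob K \<Longrightarrow> m X \<cdot> \<eta> (on_ob T X) = One K (on_ob T X)"
  using monad by (simp_all add: monad_def)

lemma is_op_type_kleisli: "is_op_type \<kappa> K kleisli_type"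
  unfolding is_op_type_def
proof (intro conjI ballI)
  fix w assume "w \<in> syms kleisli_type"
  then show "arity kleisli_type w \<in> obs kleisli_type \<times> obs kleisli_type"
    by (rule symE) (simp add: op_sym)
next
  fix X Y assume XY: "X \<in> obs kleisli_type" "Y \<in> obs kleisli_type"
  have "{w \<in> syms kleisli_type. arity kleisli_type w = (X, Y)} \<subseteq>
      op_sym X ` hom K Y (on_ob T X)"
  proof
    fix w assume "w \<in> {w \<in> syms kleisli_type. arity kleisli_type w = (X, Y)}"
    then have w: "w \<in> syms kleisli_type" "arity kleisli_type w = (X, Y)" by simp_all
    from w(1) show "w \<in> op_sym X ` hom K Y (on_ob T X)"
      by (rule symE) (use w(2) op_sym(2) in auto)
  qed
  moreover have "small \<kappa> (hom K Y (on_ob T X))"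
    using locally_small XY G_ObD T_Ob by (simp add: locally_small_def)
  ultimately show "small \<kappa> {w \<in> syms kleisli_type. arity kleisli_type w = (X, Y)}"
    using small_subset small_image by blast
qed (use G_Ob in simp)

text \<open>The first family makes the unit interpret the variables, the second makes Kleisli composition
  interpret the composition of terms.\<close>

definition kleisli_equations ::
  "('o \<times> 'o \<times> ('u, 'u) raw_term \<times> ('u, 'u) raw_term) set" where
  "kleisli_equations =
    {(X, Y, Sym (op_sym X (\<eta> X \<cdot> f)), Var f) | X Y f. X \<in> G \<and> Y \<in> G \<and> f \<in> hom K Y X} \<union>
    {(X, Z, Sym (op_sym X (m X \<cdot> (on_ar T \<omega> \<cdot> \<omega>'))), App (Sym (op_sym Y \<omega>')) (Sym (op_sym X \<omega>)))
      | X Y Z \<omega> \<omega>'. X \<in> G \<and> Y \<in> G \<and> Z \<in> G \<and> \<omega> \<in> hom K Y (on_ob T X) \<and> \<omega>' \<in> hom K Z (on_ob T Y)}"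

lemma kleisli_equations_unit:
  assumes "X \<in> G" "Y \<in> G" "f \<in> hom K Y X"
  shows "(X, Y, Sym (op_sym X (\<eta> X \<cdot> f)), Var f) \<in> kleisli_equations"
  unfolding kleisli_equations_def using assms by blast

lemma kleisli_equations_comp:
  assumes "X \<in> G" "Y \<in> G" "Z \<in> G" "\<omega> \<in> hom K Y (on_ob T X)" "\<omega>' \<in> hom K Z (on_ob T Y)"
  shows "(X, Z, Sym (op_sym X (m X \<cdot> (on_ar T \<omega> \<cdot> \<omega>'))), App (Sym (op_sym Y \<omega>')) (Sym (op_sym X \<omega>)))
    \<in> kleisli_equations"
  unfolding kleisli_equations_def using assms by blast

lemma kleisli_equations_cases:
  assumes "(X, Z, p, q) \<in> kleisli_equations"
  obtains (unit) f where "X \<in> G" "Z \<in> G" "f \<in> hom K Z X"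
      "p = Sym (op_sym X (\<eta> X \<cdot> f))" "q = Var f"
    | (comp) Y \<omega> \<omega>' where "X \<in> G" "Y \<in> G" "Z \<in> G" "\<omega> \<in> hom K Y (on_ob T X)"
      "\<omega>' \<in> hom K Z (on_ob T Y)" "p = Sym (op_sym X (m X \<cdot> (on_ar T \<omega> \<cdot> \<omega>')))"
      "q = App (Sym (op_sym Y \<omega>')) (Sym (op_sym X \<omega>))"
  using assms unfolding kleisli_equations_def by blast

lemma kleisli_comp_hom:
  assumes "X \<in> G" "\<omega> \<in> hom K Y (on_ob T X)" "\<omega>' \<in> hom K Z (on_ob T Y)"
  shows "m X \<cdot> (on_ar T \<omega> \<cdot> \<omega>') \<in> hom K Z (on_ob T X)"
  using Cmp_hom[OF Cmp_hom[OF assms(3) T_hom[OF assms(2)]] m_hom[OF G_ObD[OF assms(1)]]] .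

lemma \<eta>_comp_hom: "X \<in> G \<Longrightarrow> f \<in> hom K Y X \<Longrightarrow> \<eta> X \<cdot> f \<in> hom K Y (on_ob T X)"
  by (rule Cmp_hom[OF _ \<eta>_hom[OF G_ObD]])

lemma well_formed_kleisli_equations: "well_formed_equations K kleisli_type kleisli_equations"
proof -
  have Sym: "raw_term_of K kleisli_type X Y (Sym (op_sym X \<omega>))"
    if "X \<in> G" "Y \<in> G" "\<omega> \<in> hom K Y (on_ob T X)" for X Y \<omega>
    using op_sym[OF that] by (intro raw_term_of.Sym)
  show ?thesis
    unfolding well_formed_equations_def
  proof clarify
    fix X Y p q assume "(X, Y, p, q) \<in> kleisli_equations"
    then show "raw_term_of K kleisli_type X Y p \<and> raw_term_of K kleisli_type X Y q"
    proof (cases rule: kleisli_equations_cases)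
      case (unit f)
      then show ?thesis using Sym[OF _ _ \<eta>_comp_hom] by (simp add: raw_term_of.Var)
    next
      case (comp V \<omega> \<omega>')
      then show ?thesis
        using Sym[OF _ _ kleisli_comp_hom] Sym by (simp add: raw_term_of.App[of _ _ _ V])
    qed
  qed
qed

text \<open>For an algebra this says that \<open>X \<mapsto> hom K X A\<close> with the action
  \<open>ops\<close> is a presheaf on the full subcategory of the Kleisli category on
  \<open>G\<close>, extending the hom presheaf along the functor
  \<open>f \<mapsto> \<eta> X \<cdot> f\<close>.\<close>

definition kleisli_model :: "'o \<Rightarrow> ('u \<Rightarrow> 'u \<Rightarrow> 'u) \<Rightarrow> bool" where
  "kleisli_model A ops \<longleftrightarrow>
    (\<forall>X \<in> G. \<forall>Y \<in> G. \<forall>f \<in> hom K Y X. \<forall>x \<in> hom K X A. ops (op_sym X (\<eta> X \<cdot> f)) x = x \<cdot> f) \<and>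
    (\<forall>X \<in> G. \<forall>Y \<in> G. \<forall>Z \<in> G. \<forall>\<omega> \<in> hom K Y (on_ob T X). \<forall>\<omega>' \<in> hom K Z (on_ob T Y). \<forall>x \<in> hom K X A.
      ops (op_sym X (m X \<cdot> (on_ar T \<omega> \<cdot> \<omega>'))) x = ops (op_sym Y \<omega>') (ops (op_sym X \<omega>) x))"

lemma satisfies_iff_kleisli_model:
  assumes "(A, ops) \<in> algebras K kleisli_type"
  shows "satisfies K kleisli_type (class_equations K kleisli_type kleisli_equations) (A, ops) \<longleftrightarrow>
    kleisli_model A ops"
  unfolding satisfies_class_equations[OF category_axioms is_op_type_kleisli assms
      well_formed_kleisli_equations]
proof
  assume R: "\<forall>(X, Y, p, q) \<in> kleisli_equations. \<forall>x \<in> hom K X A.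
    raw_interp K ops p x = raw_interp K ops q x"
  show "kleisli_model A ops"
    unfolding kleisli_model_def
  proof (intro conjI ballI)
    fix X Y f x assume "X \<in> G" "Y \<in> G" "f \<in> hom K Y X" "x \<in> hom K X A"
    then show "ops (op_sym X (\<eta> X \<cdot> f)) x = x \<cdot> f"
      using bspec[OF R kleisli_equations_unit[of X Y f]] by simp
  next
    fix X Y Z \<omega> \<omega>' x
    assume "X \<in> G" "Y \<in> G" "Z \<in> G" "\<omega> \<in> hom K Y (on_ob T X)" "\<omega>' \<in> hom K Z (on_ob T Y)" "x \<in> hom K X A"
    then show "ops (op_sym X (m X \<cdot> (on_ar T \<omega> \<cdot> \<omega>'))) x = ops (op_sym Y \<omega>') (ops (op_sym X \<omega>) x)"
      using bspec[OF R kleisli_equations_comp[of X Y Z \<omega> \<omega>']] by simp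
  qed
next
  assume model: "kleisli_model A ops"
  show "\<forall>(X, Y, p, q) \<in> kleisli_equations. \<forall>x \<in> hom K X A.
    raw_interp K ops p x = raw_interp K ops q x"
  proof clarify
    fix X Z p q x assume "(X, Z, p, q) \<in> kleisli_equations" and x: "x \<in> hom K X A"
    then show "raw_interp K ops p x = raw_interp K ops q x"
      by (cases rule: kleisli_equations_cases) (use model x in \<open>simp_all add: kleisli_model_def\<close>)
  qed
qed

lemma kleisli_algebra_iff:
  "(A, ops) \<in> algebras K kleisli_type \<longleftrightarrow> A \<in> Ob K \<and>
    ops \<in> extensional (syms kleisli_type) \<and>
    (\<forall>X \<in> G. \<forall>Y \<in> G. \<forall>\<omega> \<in> hom K Y (on_ob T X). ops (op_sym X \<omega>) \<in> hom K X A \<rightarrow>\<^sub>E hom K Y A)"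
  (is "?L \<longleftrightarrow> ?R")
proof
  assume L: ?L
  have "ops (op_sym X \<omega>) \<in> hom K X A \<rightarrow>\<^sub>E hom K Y A"
    if "X \<in> G" "Y \<in> G" "\<omega> \<in> hom K Y (on_ob T X)" for X Y \<omega>
  proof -
    have "ops \<in> (\<Pi>\<^sub>E w \<in> syms kleisli_type. hom K (fst (arity kleisli_type w)) A \<rightarrow>\<^sub>E
        hom K (snd (arity kleisli_type w)) A)"
      using L by (simp add: algebras_def)
    from PiE_mem[OF this op_sym(1)[OF that]] show ?thesis using op_sym(2)[OF that] by simp
  qed
  then show ?R using L by (simp add: algebras_def PiE_def)
next
  assume R: ?R
  have "ops w \<in> hom K (fst (arity kleisli_type w)) A \<rightarrow>\<^sub>E hom K (snd (arity kleisli_type w)) A"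
    if w: "w \<in> syms kleisli_type" for w
  proof -
    obtain X Y \<omega> where *: "w = op_sym X \<omega>" "X \<in> G" "Y \<in> G" "\<omega> \<in> hom K Y (on_ob T X)"
      using symE[OF w] .
    then show ?thesis using R op_sym(2)[OF *(2-4)] by simp
  qed
  then show ?L using R by (simp add: algebras_def PiE_def Pi_def)
qed

text \<open>\<open>a \<cdot> T f\<close> is the extension of \<open>f\<close> to the free algebra,
  evaluated here at the generalized element \<open>\<omega>\<close>. Both levels are restricted
  because \<open>algebras\<close> asks for extensional functions.\<close>

definition EM_operations :: "'o \<times> 'u \<Rightarrow> 'o \<times> ('u \<Rightarrow> 'u \<Rightarrow> 'u)" where
  "EM_operations = (\<lambda>(A, a). (A, \<lambda>w\<in>syms kleisli_type. \<lambda>f\<in>hom K (fst (arity kleisli_type w)) A.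
     a \<cdot> (on_ar T f \<cdot> arrow_of w)))"

lemma EM_operations_op_sym:
  assumes "X \<in> G" "Y \<in> G" "\<omega> \<in> hom K Y (on_ob T X)" "f \<in> hom K X A"
  shows "snd (EM_operations (A, a)) (op_sym X \<omega>) f = a \<cdot> (on_ar T f \<cdot> \<omega>)"
  using op_sym[OF assms(1-3)] assms(4) by (simp add: EM_operations_def)

section \<open>Testing equality of morphisms on objects of \<open>G\<close>\<close>

lemma dense_id_ext:
  assumes "h \<in> hom K X B" "k \<in> hom K X B"
    and "\<And>Y y. Y \<in> G \<Longrightarrow> y \<in> hom K Y X \<Longrightarrow> h \<cdot> y = k \<cdot> y"
  shows "h = k"
proof (rule dense_for_ext[OF dense_id category_axioms])
  show "X \<in> Ob K" "B \<in> Ob K" using hom_Ob[OF category_axioms assms(1)] .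
  show "is_functor K K id_func" using category_axioms by (auto simp: is_functor_def id_func_def)
qed (use assms G_Ob in \<open>simp_all add: id_func_def\<close>)

lemma dense_T_ext:
  assumes "X \<in> Ob K" "h \<in> hom K (on_ob T X) B" "k \<in> hom K (on_ob T X) B"
    and "\<And>Y y. Y \<in> G \<Longrightarrow> y \<in> hom K Y X \<Longrightarrow> h \<cdot> on_ar T y = k \<cdot> on_ar T y"
  shows "h = k"
  by (rule dense_for_ext[OF dense_T[OF assms(1)] category_axioms _ T_functor])
    (use assms G_Ob hom_Ob[OF category_axioms assms(2)] in simp_all)

lemma dense_TT_ext:
  assumes "X \<in> Ob K" "h \<in> hom K (on_ob T (on_ob T X)) B" "k \<in> hom K (on_ob T (on_ob T X)) B"
    and "\<And>Y y. Y \<in> G \<Longrightarrow> y \<in> hom K Y X \<Longrightarrow>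
      h \<cdot> on_ar T (on_ar T y) = k \<cdot> on_ar T (on_ar T y)"
  shows "h = k"
  by (rule dense_for_ext[OF dense_TT[OF assms(1)] category_axioms _
        is_functor_comp_func[OF T_functor T_functor]])
    (use assms G_Ob hom_Ob[OF category_axioms assms(2)] in \<open>simp_all add: comp_func_def\<close>)

text \<open>Two reductions: density for \<open>T\<close> passes from \<open>T A\<close> to
  \<open>T X\<close> with \<open>X\<close> in \<open>G\<close>, and density for the identity from
  \<open>T X\<close> to arrows \<open>\<omega>\<close> out of \<open>G\<close>. The resulting
  composites are those seen by the operations.\<close>

lemma T_arrow_eqI:
  assumes "A \<in> Ob K" "h \<in> hom K (on_ob T A) B" "k \<in> hom K (on_ob T A) B"
    and "\<And>X Y f \<omega>. X \<in> G \<Longrightarrow> Y \<in> G \<Longrightarrow> f \<in> hom K X A \<Longrightarrow> \<omega> \<in> hom K Y (on_ob T X) \<Longrightarrow>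
      h \<cdot> (on_ar T f \<cdot> \<omega>) = k \<cdot> (on_ar T f \<cdot> \<omega>)"
  shows "h = k"
proof (rule dense_T_ext[OF assms(1-3)])
  fix X f assume f: "X \<in> G" "f \<in> hom K X A"
  show "h \<cdot> on_ar T f = k \<cdot> on_ar T f"
  proof (rule dense_id_ext[OF Cmp_hom[OF T_hom[OF f(2)] assms(2)] Cmp_hom[OF T_hom[OF f(2)] assms(3)]])
    fix Y \<omega> assume \<omega>: "Y \<in> G" "\<omega> \<in> hom K Y (on_ob T X)"
    show "h \<cdot> on_ar T f \<cdot> \<omega> = k \<cdot> on_ar T f \<cdot> \<omega>"
      using assms(4)[OF f(1) \<omega>(1) f(2) \<omega>(2)] Cmp_assoc[OF \<omega>(2) T_hom[OF f(2)]] assms(2,3)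
      by simp
  qed
qed

lemma Ar_hom: "f \<in> Ar K \<Longrightarrow> f \<in> hom K (Src K f) (Tgt K f)"
  by (simp add: hom_def)

text \<open>Membership in \<open>hom\<close> involves intermediate objects that a rewrite rule
  cannot guess; with sources and targets as functions, composability can be computed.\<close>

lemma category_simps:
  "f \<in> Ar K \<Longrightarrow> g \<in> Ar K \<Longrightarrow> Tgt K f = Src K g \<Longrightarrow> g \<cdot> f \<in> Ar K"
  "f \<in> Ar K \<Longrightarrow> g \<in> Ar K \<Longrightarrow> Tgt K f = Src K g \<Longrightarrow> Src K (g \<cdot> f) = Src K f"
  "f \<in> Ar K \<Longrightarrow> g \<in> Ar K \<Longrightarrow> Tgt K f = Src K g \<Longrightarrow> Tgt K (g \<cdot> f) = Tgt K g"
  using Cmp_hom[of f "Src K f" "Src K g" g "Tgt K g"] by (simp_all add: hom_def)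

lemma Cmp_assoc_simp:
  assumes "f \<in> Ar K" "g \<in> Ar K" "h \<in> Ar K" "Tgt K f = Src K g" "Tgt K g = Src K h"
  shows "(h \<cdot> g) \<cdot> f = h \<cdot> (g \<cdot> f)"
  using Cmp_assoc[of f "Src K f" "Src K g" g "Src K h" h "Tgt K h"] assms by (simp add: hom_def)

lemma T_simps:
  "f \<in> Ar K \<Longrightarrow> on_ar T f \<in> Ar K"
  "f \<in> Ar K \<Longrightarrow> Src K (on_ar T f) = on_ob T (Src K f)"
  "f \<in> Ar K \<Longrightarrow> Tgt K (on_ar T f) = on_ob T (Tgt K f)"
  using T_hom[OF Ar_hom, of f] by (simp_all add: hom_def)

lemma T_Cmp_simp:
  "f \<in> Ar K \<Longrightarrow> g \<in> Ar K \<Longrightarrow> Tgt K f = Src K g \<Longrightarrow> on_ar T (g \<cdot> f) = on_ar T g \<cdot> on_ar T f"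
  using T_Cmp[of f "Src K f" "Src K g" g "Tgt K g"] by (simp add: hom_def)

lemmas arrow_simps = category_simps Cmp_assoc_simp T_simps T_Cmp_simp

lemma object_simps:
  "X \<in> Ob K \<Longrightarrow> on_ob T X \<in> Ob K"
  "X \<in> Ob K \<Longrightarrow> \<eta> X \<in> Ar K" "X \<in> Ob K \<Longrightarrow> Src K (\<eta> X) = X" "X \<in> Ob K \<Longrightarrow> Tgt K (\<eta> X) = on_ob T X"
  "X \<in> Ob K \<Longrightarrow> m X \<in> Ar K" "X \<in> Ob K \<Longrightarrow> Src K (m X) = on_ob T (on_ob T X)"
  "X \<in> Ob K \<Longrightarrow> Tgt K (m X) = on_ob T X"
  using T_Ob[of X] \<eta>_hom[of X] m_hom[of X] by (simp_all add: hom_def)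

section \<open>From algebras of the monad to models of the theory\<close>

abbreviation "EM_objects \<equiv> {(A, a). A \<in> Ob K \<and> a \<in> hom K (on_ob T A) A \<and>
  a \<cdot> \<eta> A = One K A \<and> a \<cdot> on_ar T a = a \<cdot> m A}"

lemma EM_operations_hom:
  assumes "a \<in> hom K (on_ob T A) A" "f \<in> hom K X A" "\<omega> \<in> hom K Y (on_ob T X)"
  shows "a \<cdot> (on_ar T f \<cdot> \<omega>) \<in> hom K Y A"
  using Cmp_hom[OF Cmp_hom[OF assms(3) T_hom[OF assms(2)]] assms(1)] .

lemma EM_operations_algebras:
  assumes "A \<in> Ob K" "a \<in> hom K (on_ob T A) A"
  shows "EM_operations (A, a) \<in> algebras K kleisli_type"
proof -
  have "(A, snd (EM_operations (A, a))) \<in> algebras K kleisli_type"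
    unfolding kleisli_algebra_iff
  proof (intro conjI ballI)
    show "snd (EM_operations (A, a)) \<in> extensional (syms kleisli_type)"
      by (simp add: EM_operations_def)
    fix X Y \<omega> assume *: "X \<in> G" "Y \<in> G" "\<omega> \<in> hom K Y (on_ob T X)"
    have "snd (EM_operations (A, a)) (op_sym X \<omega>) \<in> extensional (hom K X A)"
      using op_sym[OF *] by (simp add: EM_operations_def)
    then show "snd (EM_operations (A, a)) (op_sym X \<omega>) \<in> hom K X A \<rightarrow>\<^sub>E hom K Y A"
      using EM_operations_op_sym[OF *] EM_operations_hom[OF assms(2) _ *(3)]
      by (auto simp: PiE_def)
  qed (use assms in simp)
  then show ?thesis by (simp add: EM_operations_def)
qed

text \<open>The first family of equations is the unit law of \<open>a\<close> carried across
  naturality of \<open>\<eta>\<close>; the second is its associativity law carried across naturality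
  of \<open>m\<close>.\<close>

lemma EM_operations_model:
  assumes "(A, a) \<in> EM_objects"
  shows "kleisli_model A (snd (EM_operations (A, a)))"
  unfolding kleisli_model_def
proof (intro conjI ballI)
  have A: "A \<in> Ob K" and a: "a \<in> Ar K" "Src K a = on_ob T A" "Tgt K a = A"
    and unit: "a \<cdot> \<eta> A = One K A" and assoc: "a \<cdot> on_ar T a = a \<cdot> m A"
    using assms by (auto simp: hom_def)
  note simps = arrow_simps object_simps A a
  {
    fix X Y f x assume *: "X \<in> G" "Y \<in> G" and f: "f \<in> hom K Y X" and x: "x \<in> hom K X A"
    have "a \<cdot> (on_ar T x \<cdot> (\<eta> X \<cdot> f)) = a \<cdot> ((on_ar T x \<cdot> \<eta> X) \<cdot> f)"
      using f x G_ObD[OF *(1)] by (simp add: hom_def simps)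
    also have "\<dots> = (a \<cdot> \<eta> A) \<cdot> (x \<cdot> f)"
      using f x unfolding \<eta>_natural[OF x, symmetric] by (simp add: hom_def simps)
    also have "\<dots> = x \<cdot> f" using One_left[OF Cmp_hom[OF f x]] by (simp add: unit)
    finally show "snd (EM_operations (A, a)) (op_sym X (\<eta> X \<cdot> f)) x = x \<cdot> f"
      using EM_operations_op_sym[OF * \<eta>_comp_hom[OF *(1) f] x] by simp
  next
    fix X Y Z \<omega> \<omega>' x
    assume *: "X \<in> G" "Y \<in> G" "Z \<in> G" and \<omega>: "\<omega> \<in> hom K Y (on_ob T X)"
      and \<omega>': "\<omega>' \<in> hom K Z (on_ob T Y)" and x: "x \<in> hom K X A"
    have y: "a \<cdot> (on_ar T x \<cdot> \<omega>) \<in> hom K Y A"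
      using EM_operations_hom[OF _ x \<omega>, of a] a by (simp add: hom_def)
    have "a \<cdot> (on_ar T (a \<cdot> (on_ar T x \<cdot> \<omega>)) \<cdot> \<omega>') =
        (a \<cdot> on_ar T a) \<cdot> (on_ar T (on_ar T x) \<cdot> (on_ar T \<omega> \<cdot> \<omega>'))"
      using \<omega> \<omega>' x by (simp add: hom_def simps)
    also have "\<dots> = a \<cdot> ((m A \<cdot> on_ar T (on_ar T x)) \<cdot> (on_ar T \<omega> \<cdot> \<omega>'))"
      unfolding assoc using \<omega> \<omega>' x by (simp add: hom_def simps)
    also have "\<dots> = a \<cdot> (on_ar T x \<cdot> (m X \<cdot> (on_ar T \<omega> \<cdot> \<omega>')))"
      unfolding m_natural[OF x] using \<omega> \<omega>' x G_ObD[OF *(1)] by (simp add: hom_def simps)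
    finally show "snd (EM_operations (A, a)) (op_sym X (m X \<cdot> (on_ar T \<omega> \<cdot> \<omega>'))) x =
        snd (EM_operations (A, a)) (op_sym Y \<omega>') (snd (EM_operations (A, a)) (op_sym X \<omega>) x)"
      using EM_operations_op_sym[OF *(1,3) kleisli_comp_hom[OF *(1) \<omega> \<omega>'] x]
        EM_operations_op_sym[OF *(1,2) \<omega> x] EM_operations_op_sym[OF *(2,3) \<omega>' y] by simp
  }
qed

text \<open>Compatibility with the symbol of \<open>\<omega>\<close> at \<open>x\<close> is the
  equation \<open>h \<cdot> a = b \<cdot> T h\<close> precomposed with
  \<open>T x \<cdot> \<omega>\<close>, and such composites detect equality.\<close>

lemma EM_operations_homomorphism:
  assumes A: "A \<in> Ob K" "a \<in> hom K (on_ob T A) A" and B: "b \<in> hom K (on_ob T B) B"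
    and h: "h \<in> hom K A B"
  shows "(\<forall>w \<in> syms kleisli_type. \<forall>x \<in> hom K (fst (arity kleisli_type w)) A.
      h \<cdot> snd (EM_operations (A, a)) w x = snd (EM_operations (B, b)) w (h \<cdot> x)) \<longleftrightarrow>
    h \<cdot> a = b \<cdot> on_ar T h"
proof -
  have eq: "h \<cdot> snd (EM_operations (A, a)) (op_sym X \<omega>) x = (h \<cdot> a) \<cdot> (on_ar T x \<cdot> \<omega>)"
    "snd (EM_operations (B, b)) (op_sym X \<omega>) (h \<cdot> x) = (b \<cdot> on_ar T h) \<cdot> (on_ar T x \<cdot> \<omega>)"
    if *: "X \<in> G" "Y \<in> G" "\<omega> \<in> hom K Y (on_ob T X)" "x \<in> hom K X A" for X Y \<omega> x
    using EM_operations_op_sym[OF *] EM_operations_op_sym[OF *(1-3) Cmp_hom[OF *(4) h]] A(2) B h *(3,4)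
    by (simp_all add: hom_def arrow_simps)
  show ?thesis
  proof
    assume hom: "\<forall>w \<in> syms kleisli_type. \<forall>x \<in> hom K (fst (arity kleisli_type w)) A.
      h \<cdot> snd (EM_operations (A, a)) w x = snd (EM_operations (B, b)) w (h \<cdot> x)"
    show "h \<cdot> a = b \<cdot> on_ar T h"
    proof (rule T_arrow_eqI[OF A(1) Cmp_hom[OF A(2) h] Cmp_hom[OF T_hom[OF h] B]])
      fix X Y f \<omega> assume *: "X \<in> G" "Y \<in> G" "f \<in> hom K X A" "\<omega> \<in> hom K Y (on_ob T X)"
      show "h \<cdot> a \<cdot> (on_ar T f \<cdot> \<omega>) = b \<cdot> on_ar T h \<cdot> (on_ar T f \<cdot> \<omega>)"
        using hom[rule_format, of "op_sym X \<omega>" f] op_sym[OF *(1,2,4)] *(3) eq[OF *(1,2,4,3)] by simp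
    qed
  next
    assume hom: "h \<cdot> a = b \<cdot> on_ar T h"
    show "\<forall>w \<in> syms kleisli_type. \<forall>x \<in> hom K (fst (arity kleisli_type w)) A.
      h \<cdot> snd (EM_operations (A, a)) w x = snd (EM_operations (B, b)) w (h \<cdot> x)"
    proof (intro ballI)
      fix w x assume w: "w \<in> syms kleisli_type" and x: "x \<in> hom K (fst (arity kleisli_type w)) A"
      obtain X Y \<omega> where *: "w = op_sym X \<omega>" "X \<in> G" "Y \<in> G" "\<omega> \<in> hom K Y (on_ob T X)"
        using symE[OF w] .
      then have "x \<in> hom K X A" using x op_sym(2)[OF *(2-4)] by simp
      from eq[OF *(2-4) this] show
        "h \<cdot> snd (EM_operations (A, a)) w x = snd (EM_operations (B, b)) w (h \<cdot> x)"
        using hom *(1) by simp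
    qed
  qed
qed

text \<open>A structure map inducing \<open>ops\<close> must satisfy
  \<open>(a \<cdot> T x) \<cdot> \<omega> = ops (op_sym X \<omega>) x\<close>. This determines each
  \<open>a \<cdot> T x\<close>, called \<open>sharp x\<close> below, and then \<open>a\<close>. The
  equations provide both the compatibility needed for gluing and the algebra laws.\<close>

lemma kleisli_model_is_EM_operations:
  assumes alg: "(A, ops) \<in> algebras K kleisli_type" and model: "kleisli_model A ops"
  obtains a where "(A, a) \<in> EM_objects" "EM_operations (A, a) = (A, ops)"
proof -
  have A: "A \<in> Ob K" and ext: "ops \<in> extensional (syms kleisli_type)"
    using alg by (simp_all add: kleisli_algebra_iff)
  have ops_PiE: "ops (op_sym X \<omega>) \<in> hom K X A \<rightarrow>\<^sub>E hom K Y A"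
    if "X \<in> G" "Y \<in> G" "\<omega> \<in> hom K Y (on_ob T X)" for X Y \<omega>
    using alg that by (simp add: kleisli_algebra_iff)
  have ops_hom: "ops (op_sym X \<omega>) x \<in> hom K Y A"
    if "X \<in> G" "Y \<in> G" "\<omega> \<in> hom K Y (on_ob T X)" "x \<in> hom K X A" for X Y \<omega> x
    using PiE_mem[OF ops_PiE[OF that(1-3)] that(4)] .
  have unit: "ops (op_sym X (\<eta> X \<cdot> f)) x = x \<cdot> f"
    if "X \<in> G" "Y \<in> G" "f \<in> hom K Y X" "x \<in> hom K X A" for X Y f x
    using model that by (simp add: kleisli_model_def)
  have mult: "ops (op_sym X (m X \<cdot> (on_ar T \<omega> \<cdot> \<omega>'))) x = ops (op_sym Y \<omega>') (ops (op_sym X \<omega>) x)"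
    if "X \<in> G" "Y \<in> G" "Z \<in> G" "\<omega> \<in> hom K Y (on_ob T X)" "\<omega>' \<in> hom K Z (on_ob T Y)" "x \<in> hom K X A"
    for X Y Z \<omega> \<omega>' x
    using model[unfolded kleisli_model_def, THEN conjunct2, rule_format, OF that] .
  note simps = arrow_simps object_simps A
  \<comment> \<open>\<open>\<omega> \<cdot> g\<close> is the Kleisli composite of
    \<open>\<omega>\<close> with \<open>\<eta> Y \<cdot> g\<close>, so both families of equations
    apply. This is the compatibility condition for gluing over \<open>T X\<close>.\<close>
  have natural: "ops (op_sym X (\<omega> \<cdot> g)) x = ops (op_sym X \<omega>) x \<cdot> g"
    if *: "X \<in> G" "Y \<in> G" "Z \<in> G" and \<omega>: "\<omega> \<in> hom K Y (on_ob T X)" and g: "g \<in> hom K Z Y"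
      and x: "x \<in> hom K X A" for X Y Z \<omega> g x
  proof -
    have X: "X \<in> Ob K" "Y \<in> Ob K" using * G_ObD by simp_all
    have "m X \<cdot> (on_ar T \<omega> \<cdot> (\<eta> Y \<cdot> g)) = m X \<cdot> ((on_ar T \<omega> \<cdot> \<eta> Y) \<cdot> g)"
      using \<omega> g X by (simp add: hom_def simps)
    also have "\<dots> = (m X \<cdot> \<eta> (on_ob T X)) \<cdot> (\<omega> \<cdot> g)"
      unfolding \<eta>_natural[OF \<omega>, symmetric] using \<omega> g X by (simp add: hom_def simps)
    also have "\<dots> = \<omega> \<cdot> g" using One_left[OF Cmp_hom[OF g \<omega>]] m_\<eta>T[OF X(1)] by simp
    finally have "ops (op_sym X (\<omega> \<cdot> g)) x = ops (op_sym Y (\<eta> Y \<cdot> g)) (ops (op_sym X \<omega>) x)"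
      using mult[OF * \<omega> \<eta>_comp_hom[OF *(2) g] x] by simp
    also have "\<dots> = ops (op_sym X \<omega>) x \<cdot> g"
      by (rule unit[OF *(2,3) g ops_hom[OF *(1,2) \<omega> x]])
    finally show ?thesis .
  qed
  \<comment> \<open>The future \<open>a \<cdot> T x\<close>. Existence and uniqueness come from
    density for the identity at \<open>T X\<close>, an object that need not lie in
    \<open>G\<close>.\<close>
  define sharp where "sharp x = (THE h. h \<in> hom K (on_ob T (Src K x)) A \<and>
    (\<forall>Y \<in> G. \<forall>\<omega> \<in> hom K Y (on_ob T (Src K x)). h \<cdot> \<omega> = ops (op_sym (Src K x) \<omega>) x))" for x
  have sharp: "sharp x \<in> hom K (on_ob T X) A \<and>
      (\<forall>Y \<in> G. \<forall>\<omega> \<in> hom K Y (on_ob T X). sharp x \<cdot> \<omega> = ops (op_sym X \<omega>) x)"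
    if X: "X \<in> G" and x: "x \<in> hom K X A" for X x
  proof -
    have [simp]: "Src K x = X" using x by (simp add: hom_def)
    have "\<exists>!h. h \<in> hom K (on_ob T X) A \<and>
      (\<forall>Y \<in> G. \<forall>\<omega> \<in> hom K Y (on_ob T X). h \<cdot> \<omega> = ops (op_sym X \<omega>) x)"
      by (rule dense_for_extend[OF dense_id[OF T_Ob[OF G_ObD[OF X]]] A,
            of "\<lambda>\<omega>. ops (op_sym X \<omega>) x", unfolded id_func_def, simplified])
        (use ops_hom[OF X _ _ x] natural[OF X _ _ _ _ x] in simp_all)
    from theI'[OF this] show ?thesis by (simp add: sharp_def)
  qed
  have sharp_hom: "sharp x \<in> hom K (on_ob T X) A" if "X \<in> G" "x \<in> hom K X A" for X x
    using sharp[OF that] by blast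
  have sharp_ops: "sharp x \<cdot> \<omega> = ops (op_sym X \<omega>) x"
    if "X \<in> G" "Y \<in> G" "x \<in> hom K X A" "\<omega> \<in> hom K Y (on_ob T X)" for X Y x \<omega>
    using sharp[OF that(1,3)] that by blast
  \<comment> \<open>Here \<open>T g \<cdot> \<omega>\<close> is recognized as the Kleisli composite
    of \<open>\<eta> X \<cdot> g\<close> with \<open>\<omega>\<close>, by the law
    \<open>m X \<cdot> T (\<eta> X) = 1\<close>.\<close>
  have sharp_natural: "sharp (x \<cdot> g) = sharp x \<cdot> on_ar T g"
    if *: "X \<in> G" "Y \<in> G" and x: "x \<in> hom K X A" and g: "g \<in> hom K Y X" for X Y x g
  proof (rule dense_id_ext[OF sharp_hom[OF *(2) Cmp_hom[OF g x]]
        Cmp_hom[OF T_hom[OF g] sharp_hom[OF *(1) x]]])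
    have X: "X \<in> Ob K" using * G_ObD by simp
    fix Z \<omega> assume Z: "Z \<in> G" and \<omega>: "\<omega> \<in> hom K Z (on_ob T Y)"
    have T\<omega>: "on_ar T g \<cdot> \<omega> \<in> hom K Z (on_ob T X)" using Cmp_hom[OF \<omega> T_hom[OF g]] .
    have "m X \<cdot> (on_ar T (\<eta> X \<cdot> g) \<cdot> \<omega>) = (m X \<cdot> on_ar T (\<eta> X)) \<cdot> (on_ar T g \<cdot> \<omega>)"
      using X g \<omega> by (simp add: hom_def simps)
    also have "\<dots> = on_ar T g \<cdot> \<omega>" using One_left[OF T\<omega>] m_T\<eta>[OF X] by simp
    finally have kl: "m X \<cdot> (on_ar T (\<eta> X \<cdot> g) \<cdot> \<omega>) = on_ar T g \<cdot> \<omega>" .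
    have "sharp (x \<cdot> g) \<cdot> \<omega> = ops (op_sym Y \<omega>) (x \<cdot> g)"
      by (rule sharp_ops[OF *(2) Z Cmp_hom[OF g x] \<omega>])
    also have "\<dots> = ops (op_sym Y \<omega>) (ops (op_sym X (\<eta> X \<cdot> g)) x)"
      using unit[OF * g x] by simp
    also have "\<dots> = ops (op_sym X (on_ar T g \<cdot> \<omega>)) x"
      using mult[OF * Z \<eta>_comp_hom[OF *(1) g] \<omega> x] kl by simp
    also have "\<dots> = sharp x \<cdot> (on_ar T g \<cdot> \<omega>)" using sharp_ops[OF *(1) Z x T\<omega>] by simp
    also have "\<dots> = (sharp x \<cdot> on_ar T g) \<cdot> \<omega>"
      by (rule Cmp_assoc[OF \<omega> T_hom[OF g] sharp_hom[OF *(1) x]])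
    finally show "sharp (x \<cdot> g) \<cdot> \<omega> = sharp x \<cdot> on_ar T g \<cdot> \<omega>" .
  qed
  have "\<exists>!a. a \<in> hom K (on_ob T A) A \<and> (\<forall>X \<in> G. \<forall>x \<in> hom K X A. a \<cdot> on_ar T x = sharp x)"
    by (rule dense_for_extend[OF dense_T[OF A] A]) (rule sharp_hom sharp_natural, assumption+)+
  then obtain a where a: "a \<in> hom K (on_ob T A) A"
    and a_sharp: "\<And>X x. X \<in> G \<Longrightarrow> x \<in> hom K X A \<Longrightarrow> a \<cdot> on_ar T x = sharp x"
    by blast
  have a_ops: "a \<cdot> (on_ar T x \<cdot> \<omega>) = ops (op_sym X \<omega>) x"
    if "X \<in> G" "Y \<in> G" "x \<in> hom K X A" "\<omega> \<in> hom K Y (on_ob T X)" for X Y x \<omega>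
    using Cmp_assoc[OF that(4) T_hom[OF that(3)] a] a_sharp[OF that(1,3)] sharp_ops[OF that] by simp
  have a_unit: "a \<cdot> \<eta> A = One K A"
  proof (rule dense_id_ext[OF Cmp_hom[OF \<eta>_hom[OF A] a] One_hom[OF A]])
    fix X x assume X: "X \<in> G" and x: "x \<in> hom K X A"
    have XO: "X \<in> Ob K" using G_ObD[OF X] .
    have "a \<cdot> \<eta> A \<cdot> x = a \<cdot> (on_ar T x \<cdot> \<eta> X)"
      using Cmp_assoc[OF x \<eta>_hom[OF A] a] \<eta>_natural[OF x] by simp
    \<comment> \<open>Written with an identity, the unit of \<open>X\<close> becomes the symbol that
      the unit equation equates with a variable.\<close>
    also have "\<dots> = ops (op_sym X (\<eta> X \<cdot> One K X)) x"
      using a_ops[OF X X x \<eta>_hom[OF XO]] One_right[OF \<eta>_hom[OF XO]] by simp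
    also have "\<dots> = x" using unit[OF X X One_hom[OF XO] x] One_right[OF x] by simp
    finally show "a \<cdot> \<eta> A \<cdot> x = One K A \<cdot> x" using One_left[OF x] by simp
  qed
  \<comment> \<open>This will make \<open>sharp x\<close> a homomorphism from the free algebra on
    \<open>X\<close>. Tested over \<open>T (T X)\<close>, it becomes an instance of the composition
    equations.\<close>
  have sharp_mult: "a \<cdot> on_ar T (sharp x) = sharp x \<cdot> m X" if X: "X \<in> G" and x: "x \<in> hom K X A" for X x
  proof -
    have XO: "X \<in> Ob K" using G_ObD[OF X] .
    note s = sharp_hom[OF X x]
    show ?thesis
    proof (rule T_arrow_eqI[OF T_Ob[OF XO] Cmp_hom[OF T_hom[OF s] a] Cmp_hom[OF m_hom[OF XO] s]])
      fix Y Z y z assume Y: "Y \<in> G" and Z: "Z \<in> G" and y: "y \<in> hom K Y (on_ob T X)"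
        and z: "z \<in> hom K Z (on_ob T Y)"
      note y' = ops_hom[OF X Y y x]
      have "(a \<cdot> on_ar T (sharp x)) \<cdot> (on_ar T y \<cdot> z) = a \<cdot> (on_ar T (sharp x \<cdot> y) \<cdot> z)"
        using a s y z by (simp add: hom_def simps)
      also have "\<dots> = ops (op_sym Y z) (ops (op_sym X y) x)"
        using sharp_ops[OF X Y x y] a_ops[OF Y Z y' z] by simp
      also have "\<dots> = sharp x \<cdot> (m X \<cdot> (on_ar T y \<cdot> z))"
        using mult[OF X Y Z y z x] sharp_ops[OF X Z x kleisli_comp_hom[OF X y z]] by simp
      also have "\<dots> = (sharp x \<cdot> m X) \<cdot> (on_ar T y \<cdot> z)"
        using s y z XO by (simp add: hom_def simps)
      finally show "a \<cdot> on_ar T (sharp x) \<cdot> (on_ar T y \<cdot> z) = sharp x \<cdot> m X \<cdot> (on_ar T y \<cdot> z)" .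
    qed
  qed
  \<comment> \<open>Density for the double functor reduces associativity to composites with
    \<open>T (T x)\<close> for \<open>x\<close> out of an arity; there it follows from
    \<open>sharp_mult\<close> and naturality of \<open>m\<close>.\<close>
  have a_assoc: "a \<cdot> on_ar T a = a \<cdot> m A"
  proof (rule dense_TT_ext[OF A Cmp_hom[OF T_hom[OF a] a] Cmp_hom[OF m_hom[OF A] a]])
    fix X x assume X: "X \<in> G" and x: "x \<in> hom K X A"
    have "a \<cdot> on_ar T a \<cdot> on_ar T (on_ar T x) = a \<cdot> on_ar T (a \<cdot> on_ar T x)"
      using a x by (simp add: hom_def simps)
    also have "\<dots> = (a \<cdot> on_ar T x) \<cdot> m X" using a_sharp[OF X x] sharp_mult[OF X x] by simp
    also have "\<dots> = a \<cdot> (m A \<cdot> on_ar T (on_ar T x))"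
      unfolding m_natural[OF x] using a x G_ObD[OF X] by (simp add: hom_def simps)
    also have "\<dots> = a \<cdot> m A \<cdot> on_ar T (on_ar T x)"
      using a x by (simp add: hom_def simps)
    finally show "a \<cdot> on_ar T a \<cdot> on_ar T (on_ar T x) = a \<cdot> m A \<cdot> on_ar T (on_ar T x)" .
  qed
  have "snd (EM_operations (A, a)) = ops"
  proof (rule extensionalityI[OF _ ext])
    show "snd (EM_operations (A, a)) \<in> extensional (syms kleisli_type)"
      by (simp add: EM_operations_def)
    fix w assume w: "w \<in> syms kleisli_type"
    obtain X Y \<omega> where *: "w = op_sym X \<omega>" "X \<in> G" "Y \<in> G" "\<omega> \<in> hom K Y (on_ob T X)"
      using symE[OF w] .
    show "snd (EM_operations (A, a)) w = ops w"
    proof (rule extensionalityI)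
      show "snd (EM_operations (A, a)) w \<in> extensional (hom K X A)"
        using w op_sym(2)[OF *(2-4)] *(1) by (simp add: EM_operations_def)
      show "ops w \<in> extensional (hom K X A)"
        using ops_PiE[OF *(2-4)] *(1) by (simp add: PiE_def)
      fix x assume x: "x \<in> hom K X A"
      show "snd (EM_operations (A, a)) w x = ops w x"
        using EM_operations_op_sym[OF *(2-4) x] a_ops[OF *(2,3) x *(4)] *(1) by simp
    qed
  qed
  then have "EM_operations (A, a) = (A, ops)" by (simp add: EM_operations_def)
  then show thesis using that[of a] A a a_unit a_assoc by simp
qed

text \<open>On objects, injectivity holds because \<open>a\<close> is determined by the composites
  \<open>a \<cdot> (T f \<cdot> \<omega>)\<close>, and surjectivity is the reconstruction of
  \<open>a\<close> from a model.\<close>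

lemma concretely_equivalent_kleisli:
  "concretely_equivalent K (EM_cat K T \<eta> m) forgetful
     (Alg K kleisli_type (class_equations K kleisli_type kleisli_equations)) forgetful"
  unfolding EM_cat_def Alg_def
proof (rule concretely_equivalent_structured_cat[OF category_axioms, where \<phi> = EM_operations])
  let ?S = "{x \<in> algebras K kleisli_type.
    satisfies K kleisli_type (class_equations K kleisli_type kleisli_equations) x}"
  have fst_EM: "EM_operations (A, a) = (A, snd (EM_operations (A, a)))" for A a
    by (simp add: EM_operations_def)
  show "bij_betw EM_operations EM_objects ?S"
    unfolding bij_betw_def
  proof (intro conjI inj_onI set_eqI)
    fix x y assume x: "x \<in> EM_objects" and y: "y \<in> EM_objects" and eq: "EM_operations x = EM_operations y"
    obtain A a B b where [simp]: "x = (A, a)" "y = (B, b)" by (cases x, cases y)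
    have [simp]: "B = A" using eq by (simp add: EM_operations_def)
    have A: "A \<in> Ob K" "a \<in> hom K (on_ob T A) A" "b \<in> hom K (on_ob T A) A"
      using x y by simp_all
    have "a = b"
    proof (rule T_arrow_eqI[OF A])
      fix X Y f \<omega> assume *: "X \<in> G" "Y \<in> G" "f \<in> hom K X A" "\<omega> \<in> hom K Y (on_ob T X)"
      show "a \<cdot> (on_ar T f \<cdot> \<omega>) = b \<cdot> (on_ar T f \<cdot> \<omega>)"
        using EM_operations_op_sym[OF *(1,2,4,3), of a] EM_operations_op_sym[OF *(1,2,4,3), of b] eq
        by simp
    qed
    then show "x = y" by simp
  next
    fix y show "y \<in> EM_operations ` EM_objects \<longleftrightarrow> y \<in> ?S"
    proof
      assume "y \<in> EM_operations ` EM_objects"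
      then obtain A a where Aa: "(A, a) \<in> EM_objects" and y: "y = EM_operations (A, a)" by force
      have alg: "(A, snd (EM_operations (A, a))) \<in> algebras K kleisli_type"
        using EM_operations_algebras[of A a] Aa fst_EM[of A a] by simp
      show "y \<in> ?S"
        using alg satisfies_iff_kleisli_model[OF alg] EM_operations_model[OF Aa] y fst_EM[of A a] by simp
    next
      assume y: "y \<in> ?S"
      obtain A ops where [simp]: "y = (A, ops)" by (cases y)
      have alg: "(A, ops) \<in> algebras K kleisli_type" using y by simp
      have "kleisli_model A ops" using y satisfies_iff_kleisli_model[OF alg] by simp
      from kleisli_model_is_EM_operations[OF alg this] obtain a
        where a: "(A, a) \<in> EM_objects" "EM_operations (A, a) = y" by auto
      show "y \<in> EM_operations ` EM_objects"
        using imageI[OF a(1), of EM_operations] unfolding a(2) .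
    qed
  qed
next
  fix x y h
  assume x: "x \<in> EM_objects" and y: "y \<in> EM_objects" and h: "h \<in> hom K (fst x) (fst y)"
  obtain A a B b where [simp]: "x = (A, a)" "y = (B, b)" by (cases x, cases y)
  show "(case EM_operations x of (A, opsA) \<Rightarrow> \<lambda>(B, opsB) h. \<forall>w \<in> syms kleisli_type.
        \<forall>a \<in> hom K (fst (arity kleisli_type w)) A. h \<cdot> opsA w a = opsB w (h \<cdot> a)) (EM_operations y) h \<longleftrightarrow>
      (case x of (A, a) \<Rightarrow> \<lambda>(B, b) h. h \<cdot> a = b \<cdot> on_ar T h) y h"
    using EM_operations_homomorphism[of A a b B h] x y h by (simp add: EM_operations_def)
next
  fix x y z f g
  assume "x \<in> EM_objects" "y \<in> EM_objects" "z \<in> EM_objects"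
    and "f \<in> hom K (fst x) (fst y)" "g \<in> hom K (fst y) (fst z)"
    and "(case x of (A, a) \<Rightarrow> \<lambda>(B, b) h. h \<cdot> a = b \<cdot> on_ar T h) y f"
      "(case y of (A, a) \<Rightarrow> \<lambda>(B, b) h. h \<cdot> a = b \<cdot> on_ar T h) z g"
  moreover obtain A a B b C c where "x = (A, a)" "y = (B, b)" "z = (C, c)"
    by (cases x, cases y, cases z)
  ultimately have a: "a \<in> hom K (on_ob T A) A" and b: "b \<in> hom K (on_ob T B) B"
    and c: "c \<in> hom K (on_ob T C) C"
    and f: "f \<in> hom K A B" "f \<cdot> a = b \<cdot> on_ar T f" and g: "g \<in> hom K B C" "g \<cdot> b = c \<cdot> on_ar T g"
    and [simp]: "x = (A, a)" "y = (B, b)" "z = (C, c)"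
    by simp_all
  have "(g \<cdot> f) \<cdot> a = (g \<cdot> b) \<cdot> on_ar T f"
    using Cmp_assoc[OF a f(1) g(1)] Cmp_assoc[OF T_hom[OF f(1)] b g(1)] f(2) by simp
  also have "\<dots> = c \<cdot> on_ar T (g \<cdot> f)"
    using Cmp_assoc[OF T_hom[OF f(1)] T_hom[OF g(1)] c] T_Cmp[OF f(1) g(1)] g(2) by simp
  finally show "(case x of (A, a) \<Rightarrow> \<lambda>(B, b) h. h \<cdot> a = b \<cdot> on_ar T h) z (g \<cdot> f)" by simp
next
  fix x assume "x \<in> EM_objects"
  then show "(case x of (A, a) \<Rightarrow> \<lambda>(B, b) h. h \<cdot> a = b \<cdot> on_ar T h) x (One K (fst x))"
    using One_left One_right T_One by auto
qed (auto simp: EM_operations_def)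

end

section \<open>Dense sets of generated objects\<close>

lemma preserves_directed_colimits_id:
  assumes "category K"
  shows "preserves_directed_colimits \<kappa> \<alpha> K M K id_func"
proof -
  have "is_functor K K id_func"
    by (rule is_functorI[OF assms assms]) (simp_all add: id_func_def)
  moreover have "comp_func id_func D = D" for D :: "('c, 'c \<times> 'c, 'a, 'b) func"
    by (simp add: comp_func_def id_func_def comp_def)
  ultimately show ?thesis
    by (simp add: preserves_directed_colimits_def) (simp add: id_func_def)
qed

text \<open>\<open>F\<close> turns a directed diagram of \<open>M\<close>-morphisms into another
  one, with colimit the image of the old colimit, so preservation by \<open>G\<close> applies to the
  image.\<close>

lemma preserves_directed_colimits_comp:
  assumes F: "preserves_directed_colimits \<kappa> \<alpha> K M K F" and G: "preserves_directed_colimits \<kappa> \<alpha> K M K G"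
    and M: "\<forall>f \<in> M. on_ar F f \<in> M"
  shows "preserves_directed_colimits \<kappa> \<alpha> K M K (comp_func G F)"
  unfolding preserves_directed_colimits_def
proof (intro conjI allI impI)
  show "is_functor K K (comp_func G F)"
    using F G is_functor_comp_func unfolding preserves_directed_colimits_def by blast
  fix r D X c assume "directed_diagram \<kappa> \<alpha> K M r D \<and> is_colimit (poset_cat r) K D X c"
  then have D: "directed_diagram \<kappa> \<alpha> K M r D" and c: "is_colimit (poset_cat r) K D X c"
    by simp_all
  have Fc: "is_colimit (poset_cat r) K (comp_func F D) (on_ob F X) (\<lambda>i. on_ar F (c i))"
    using F D c unfolding preserves_directed_colimits_def by blast
  then have "is_functor (poset_cat r) K (comp_func F D)" by (simp add: is_colimit_def cocone_def)
  then have "directed_diagram \<kappa> \<alpha> K M r (comp_func F D)"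
    using D M by (simp add: directed_diagram_def comp_func_def)
  with Fc have "is_colimit (poset_cat r) K (comp_func G (comp_func F D)) (on_ob G (on_ob F X))
      (\<lambda>i. on_ar G (on_ar F (c i)))"
    using G unfolding preserves_directed_colimits_def by blast
  then show "is_colimit (poset_cat r) K (comp_func (comp_func G F) D) (on_ob (comp_func G F) X)
      (\<lambda>i. on_ar (comp_func G F) (c i))"
    by (simp add: comp_func_def comp_assoc)
qed

text \<open>A presentation of \<open>X\<close> by objects of \<open>\<A>\<close> is a diagram in
  \<open>G\<close>; its colimit is preserved by \<open>F\<close>, and arrows out of objects of
  \<open>G\<close> factor through its legs because these objects are generated.\<close>

lemma dense_for_preserving:
  fixes K :: "('o, 'u) cat"
  assumes "inaccessible \<kappa>" and F: "preserves_directed_colimits \<kappa> \<alpha> K M K F"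
    and X: "directed_colimit_of \<kappa> \<alpha> K M \<A> X" and G: "\<A> \<subseteq> G" "\<forall>Y \<in> G. generated_object \<kappa> \<alpha> K M Y"
  shows "dense_for K G F X"
proof -
  obtain r D c where D: "directed_diagram \<kappa> \<alpha> K M r D" "\<forall>i \<in> Field r. on_ob D i \<in> \<A>"
    and c: "is_colimit (poset_cat r) K D X c"
    using X by (auto simp: directed_colimit_of_def)
  show ?thesis
  proof (rule dense_for_colimit[OF _ c])
    show "is_functor K K F" using F by (simp add: preserves_directed_colimits_def)
    show "is_colimit (poset_cat r) K (comp_func F D) (on_ob F X) (\<lambda>i. on_ar F (c i))"
      using F D(1) c unfolding preserves_directed_colimits_def by blast
    show "G \<subseteq> Ob K" using G(2) by (auto simp: generated_object_def)
    fix Y y assume "Y \<in> G" "y \<in> hom K Y X"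
    then show "\<exists>i \<in> Ob (poset_cat r). \<exists>g \<in> hom K Y (on_ob D i). y = c i \<cdot>\<^bsub>K\<^esub> g"
      using generated_factor[OF assms(1) _ D(1) c] G(2) by simp
  qed (use D(2) G(1) in auto)
qed

theorem theorem3p21:
  fixes \<kappa> :: "'u rel" and lam :: "'l rel" and mu :: "'m rel"
    and K :: "('o, 'u) cat" and E M :: "'u set"
    and T :: "('o, 'u, 'o, 'u) func" and \<eta> m :: "'o \<Rightarrow> 'u"
  assumes "inaccessible \<kappa>"
    and "regular_cardinal lam" and "regular_cardinal mu" and "lam \<le>o mu" and "mu <o \<kappa>"
    and "category K" and "locally_small \<kappa> K"
    and "locally_generated \<kappa> lam K E M"
    and "locally_presentable \<kappa> mu K"
    and "monad K T \<eta> m"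
    and "preserves_directed_colimits \<kappa> mu K (Ar K) K T"
    and "\<forall>f \<in> M. on_ar T f \<in> M"
    and "preserves_directed_colimits \<kappa> lam K M K T"
  shows "\<exists>(t :: ('o, 'u) op_type) Eq.
    generated_ary \<kappa> lam K M t \<and> equational_theory K t Eq \<and>
    concretely_equivalent K (EM_cat K T \<eta> m) forgetful (Alg K t Eq) forgetful"
proof -
  note T = assms(13) and TT = preserves_directed_colimits_comp[OF assms(13) assms(13) assms(12)]
  obtain \<A> where \<A>: "small \<kappa> \<A>" "\<forall>A \<in> \<A>. generated_object \<kappa> lam K M A"
    "\<forall>X \<in> Ob K. directed_colimit_of \<kappa> lam K M \<A> X"
    using assms(8) by (auto simp: locally_generated_def)
  obtain G where G: "small \<kappa> G" "\<A> \<subseteq> G" "\<forall>X \<in> G. generated_object \<kappa> lam K M X"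
    "\<forall>X. generated_object \<kappa> lam K M X \<longrightarrow> (\<exists>Y \<in> G. isomorphic K X Y)"
    using small_representatives_of_generated[OF assms(1,6,7) \<A>] .
  have G_Ob: "G \<subseteq> Ob K" using G(3) by (auto simp: generated_object_def)
  let ?S = "{(X, \<omega>). X \<in> G \<and> \<omega> \<in> Ar K \<and> Src K \<omega> \<in> G \<and> Tgt K \<omega> = on_ob T X}"
  have T_Ob: "on_ob T X \<in> Ob K" if "X \<in> Ob K" for X
    using T that by (simp add: preserves_directed_colimits_def is_functor_def)
  \<comment> \<open>Local smallness bounds the Kleisli morphisms between two arities and
    \<open>G\<close> is small, so all symbols together can be coded injectively in
    \<open>'u\<close>.\<close>
  have "small \<kappa> (\<Union>X\<in>G. \<Union>Y\<in>G. Pair X ` hom K Y (on_ob T X))"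
    by (intro small_UN[OF assms(1)] G(1) small_image)
      (use assms(7) G_Ob T_Ob in \<open>auto simp: locally_small_def\<close>)
  moreover have "?S \<subseteq> (\<Union>X\<in>G. \<Union>Y\<in>G. Pair X ` hom K Y (on_ob T X))"
    by (auto simp: hom_def)
  ultimately have "small \<kappa> ?S" by (rule small_subset)
  then obtain enc :: "'o \<times> 'u \<Rightarrow> 'u" where enc: "inj_on enc ?S"
    by (rule small_inj_into_universe[OF assms(1)])
  note dense = dense_for_preserving[OF assms(1) _ \<A>(3)[rule_format] G(2,3)]
  interpret kleisli_arities K \<kappa> T \<eta> m G enc
    unfolding kleisli_arities_def kleisli_arities_axioms_def
    using assms(6,7,10) G_Ob enc dense[OF preserves_directed_colimits_id[OF assms(6)]]
      dense[OF T] dense[OF TT] by simp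
  have "generated_ary \<kappa> lam K M kleisli_type"
    unfolding generated_ary_def using is_op_type_kleisli G by simp
  then show ?thesis
    using concretely_equivalent_kleisli
      equational_theory_class_equations[OF is_op_type_kleisli well_formed_kleisli_equations]
    by blast
qed

end
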